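(* For every integer $n\ge 1$, $$\psi_{sq}(G_{3,n})=\beta_2(G_{3,n})=\left\lceil\frac{5n}{3}\right\rceil,$$ $$\psi_{sq}(G_{4,n})=\beta_2(G_{4,n})=\begin{cases}2n,&n\text{ even},\\2n+1,&n\text{ odd},\end{cases}$$ $$\psi_{sq}(G_{5,n})=\beta_2(G_{5,n})=\max\left\{3\left\lceil\frac{2n}{3}\right\rceil+2\left\lfloor\frac n3\right\rfloor,\ 4\left\lceil\frac n2\right\rceil+\left\lfloor\frac n2\right\rfloor\right\},$$ $$\psi_{sq}(G_{6,n})=\beta_2(G_{6,n})=\begin{cases}3n,&n\text{ even},\\3n+1,&n\text{ odd},\end{cases}$$ $$\psi_{sq}(G_{7,n})=\beta_2(G_{7,n})=\max\left\{4\left\lceil\frac{2n}{3}\right\rceil+3\left\lfloor\frac n3\right\rfloor,\ 5\left\lceil\frac n2\right\rceil+2\left\lfloor\frac n2\right\rfloor\right\}.$$ Moreover, for each $m\in\{8,9,10,11\}$ and every integer $n\ge1$, $$\psi_{sq}(G_{m,n})=\beta_2(G_{m,n})=\Omega(G_{m,n})=F(m,n).$$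
   Context: All graphs are finite, simple and undirected. $G_{m,n}=P_m\square P_n$ is the rectangular grid graph ($P_k$ the path on $k$ vertices). A sub-quorum coloring of $G$ with $k$ colors is an onto partial map $f:V(G)\dashrightarrow\{1,\ldots,k\}$ such that, with $S=\operatorname{dom}(f)$, every $v\in S$ satisfies $|\{u\in N_G[v]\cap S: f(u)=f(v)\}|\ge\frac12|N_G[v]\cap S|$, where $N_G[v]$ is the closed neighborhood of $v$; $\psi_{sq}(G)$ is the maximum such $k$. A set $S\subseteq V(G)$ is $2$-independent if the induced subgraph $G[S]$ has maximum degree at most $1$; $\beta_2(G)$ is the maximum cardinality of a $2$-independent set. $\Omega(G)$ is the maximum of $|T|+|M|$ over all pairs $(T,M)$ where $M$ is a matching of $G$ (possibly empty) with endpoint set $V(M)$, $T\subseteq V(G)$ is disjoint from $V(M)$, and every $t\in T$ has at most one neighbor in $T\cup V(M)$. Finally $$F(m,n)=\max\left\{\left\lceil\tfrac m2\right\rceil\left\lceil\tfrac{2n}3\right\rceil+\left\lfloor\tfrac m2\right\rfloor\left\lfloor\tfrac n3\right\rfloor,\ \left\lceil\tfrac n2\right\rceil\left\lceil\tfrac{2m}3\right\rceil+\left\lfloor\tfrac n2\right\rfloor\left\lfloor\tfrac m3\right\rfloor\right\}.$$ *)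

theory Defs
  imports Complex_Main
begin

record 'a ugraph =
  verts :: "'a set"
  edges :: "'a set set"

definition simple_graph :: "'a ugraph \<Rightarrow> bool" where
  "simple_graph G \<longleftrightarrow> finite (verts G) \<and> (\<forall>e\<in>edges G. e \<subseteq> verts G \<and> card e = 2)"

definition nbhd :: "'a ugraph \<Rightarrow> 'a \<Rightarrow> 'a set" where
  "nbhd G v = {u \<in> verts G. {u, v} \<in> edges G}"

definition closed_nbhd :: "'a ugraph \<Rightarrow> 'a \<Rightarrow> 'a set" where
  "closed_nbhd G v = insert v (nbhd G v)"

definition degree :: "'a ugraph \<Rightarrow> 'a \<Rightarrow> nat" where
  "degree G v = card (nbhd G v)"

definition induced_subgraph :: "'a ugraph \<Rightarrow> 'a set \<Rightarrow> 'a ugraph" where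
  "induced_subgraph G S = \<lparr>verts = S, edges = {e \<in> edges G. e \<subseteq> S}\<rparr>"

definition path_graph :: "nat \<Rightarrow> nat ugraph" where
  "path_graph k = \<lparr>verts = {1..k}, edges = {{i, i + 1} | i. 1 \<le> i \<and> i < k}\<rparr>"

definition cartesian_product :: "'a ugraph \<Rightarrow> 'b ugraph \<Rightarrow> ('a \<times> 'b) ugraph" where
  "cartesian_product G H =
    \<lparr>verts = verts G \<times> verts H,
     edges = {{(a, b), (a, b')} | a b b'. a \<in> verts G \<and> {b, b'} \<in> edges H}
           \<union> {{(a, b), (a', b)} | a a' b. {a, a'} \<in> edges G \<and> b \<in> verts H}\<rparr>"

definition grid :: "nat \<Rightarrow> nat \<Rightarrow> (nat \<times> nat) ugraph" where
  "grid m n = cartesian_product (path_graph m) (path_graph n)"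

text \<open>The equation for \<open>ran f\<close> says both that the colors lie in \<open>{1..k}\<close> and that each is used.\<close>

definition sub_quorum_coloring :: "'a ugraph \<Rightarrow> nat \<Rightarrow> ('a \<rightharpoonup> nat) \<Rightarrow> bool" where
  "sub_quorum_coloring G k f \<longleftrightarrow>
     dom f \<subseteq> verts G \<and> ran f = {1..k} \<and>
     (\<forall>v\<in>dom f. real (card {u \<in> closed_nbhd G v \<inter> dom f. f u = f v})
                 \<ge> 1 / 2 * real (card (closed_nbhd G v \<inter> dom f)))"

definition psi_sq :: "'a ugraph \<Rightarrow> nat" where
  "psi_sq G = Max {k. \<exists>f. sub_quorum_coloring G k f}"

definition two_independent :: "'a ugraph \<Rightarrow> 'a set \<Rightarrow> bool" where
  "two_independent G S \<longleftrightarrow> S \<subseteq> verts G \<and> (\<forall>v\<in>S. degree (induced_subgraph G S) v \<le> 1)"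

definition beta2 :: "'a ugraph \<Rightarrow> nat" where
  "beta2 G = Max {card S | S. two_independent G S}"

definition matching :: "'a ugraph \<Rightarrow> 'a set set \<Rightarrow> bool" where
  "matching G M \<longleftrightarrow> M \<subseteq> edges G \<and> (\<forall>e\<in>M. \<forall>e'\<in>M. e \<noteq> e' \<longrightarrow> e \<inter> e' = {})"

text \<open>The endpoint set of a matching \<open>M\<close> is \<open>\<Union>M\<close>.\<close>

definition omega_pair :: "'a ugraph \<Rightarrow> 'a set \<Rightarrow> 'a set set \<Rightarrow> bool" where
  "omega_pair G T M \<longleftrightarrow>
     matching G M \<and> T \<subseteq> verts G \<and> T \<inter> \<Union>M = {} \<and>
     (\<forall>t\<in>T. card (nbhd G t \<inter> (T \<union> \<Union>M)) \<le> 1)"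

definition Omega :: "'a ugraph \<Rightarrow> nat" where
  "Omega G = Max {card T + card M | T M. omega_pair G T M}"

definition F :: "nat \<Rightarrow> nat \<Rightarrow> int" where
  "F m n = max
     (\<lceil>real m / 2\<rceil> * \<lceil>2 * real n / 3\<rceil> + \<lfloor>real m / 2\<rfloor> * \<lfloor>real n / 3\<rfloor>)
     (\<lceil>real n / 2\<rceil> * \<lceil>2 * real m / 3\<rceil> + \<lfloor>real n / 2\<rfloor> * \<lfloor>real m / 3\<rfloor>)"

text \<open>Grids are finite simple graphs, and on such graphs the three sets whose maximum is taken
  above are finite and nonempty.\<close>

lemma simple_graph_grid: "simple_graph (grid m n)"
  by (auto simp: simple_graph_def grid_def cartesian_product_def path_graph_def doubleton_eq_iff)

lemma simple_graph_finite_edges: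
  assumes "simple_graph G"
  shows "finite (edges G)"
proof (rule finite_subset)
  show "edges G \<subseteq> Pow (verts G)" using assms by (auto simp: simple_graph_def)
  show "finite (Pow (verts G))" using assms by (simp add: simple_graph_def)
qed

lemma psi_sq_wf:
  assumes "simple_graph G"
  shows "finite {k. \<exists>f. sub_quorum_coloring G k f}" "{k. \<exists>f. sub_quorum_coloring G k f} \<noteq> {}"
proof -
  have "k \<le> card (verts G)" if "sub_quorum_coloring G k f" for k f
  proof -
    have fin: "finite (dom f)" and le: "card (dom f) \<le> card (verts G)"
      using that assms by (auto simp: sub_quorum_coloring_def simple_graph_def
          intro: finite_subset card_mono)
    have "ran f \<subseteq> (\<lambda>x. the (f x)) ` dom f" by (force simp: ran_def)
    then have "card (ran f) \<le> card (dom f)" by (rule surj_card_le[OF fin])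
    then show ?thesis using that le by (simp add: sub_quorum_coloring_def)
  qed
  then have "{k. \<exists>f. sub_quorum_coloring G k f} \<subseteq> {..card (verts G)}" by auto
  then show "finite {k. \<exists>f. sub_quorum_coloring G k f}" by (rule finite_subset) simp
  have "sub_quorum_coloring G 0 Map.empty" by (simp add: sub_quorum_coloring_def)
  then show "{k. \<exists>f. sub_quorum_coloring G k f} \<noteq> {}" by blast
qed

lemma beta2_wf:
  assumes "simple_graph G"
  shows "finite {card S | S. two_independent G S}" "{card S | S. two_independent G S} \<noteq> {}"
proof -
  have "{card S | S. two_independent G S} \<subseteq> card ` Pow (verts G)"
    by (auto simp: two_independent_def)
  then show "finite {card S | S. two_independent G S}"
    by (rule finite_subset) (use assms in \<open>simp add: simple_graph_def\<close>)
  have "two_independent G {}" by (simp add: two_independent_def)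
  then show "{card S | S. two_independent G S} \<noteq> {}" by blast
qed

lemma Omega_wf:
  assumes "simple_graph G"
  shows "finite {card T + card M | T M. omega_pair G T M}"
    "{card T + card M | T M. omega_pair G T M} \<noteq> {}"
proof -
  have "{card T + card M | T M. omega_pair G T M}
      \<subseteq> (\<lambda>(T, M). card T + card M) ` (Pow (verts G) \<times> Pow (edges G))"
    by (auto simp: omega_pair_def matching_def image_iff)
  then show "finite {card T + card M | T M. omega_pair G T M}"
    by (rule finite_subset)
      (use assms simple_graph_finite_edges[OF assms] in \<open>simp add: simple_graph_def\<close>)
  have "omega_pair G {} {}" by (simp add: omega_pair_def matching_def)
  then show "{card T + card M | T M. omega_pair G T M} \<noteq> {}" by blast
qed

end

theory Submission
  imports Defs
begin

text \<open>
All three parameters equal \<open>F m n\<close> on every grid, whatever \<open>m\<close> and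
\<open>n\<close>; the five formulas for small \<open>m\<close> are special values of
\<open>F\<close>. Two comparisons hold on all graphs: a 2-independent set can be coloured with
distinct colours (\<open>beta2_le_psi_sq\<close>), and a sub-quorum colouring yields a vertex or
a matching edge for each colour (\<open>psi_sq_le_Omega\<close>). An explicit set of stripes
shows that \<open>F\<close> is a lower bound for \<open>\<beta>\<^sub>2\<close>. What remains is
that \<open>F\<close> is an upper bound for \<open>\<Omega>\<close>.

Let \<open>(T, M)\<close> be a pair as in the definition of \<open>\<Omega>\<close>, and call a
cell empty if it is covered neither by \<open>T\<close> nor by \<open>M\<close>. Twice
\<open>card T + card M\<close> exceeds the number of cells by the surplus, the number of cells
of \<open>T\<close> minus the number of empty cells. Colour the cells like a chessboard with
values \<open>1\<close> and \<open>-1\<close>, and give each cell a phase: its colour if it lies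
in \<open>T\<close>, minus its colour if it is empty, and \<open>0\<close> if it lies in
\<open>M\<close>. Then the surplus is the sum of colour times phase. Consider the connected
components \<open>K\<close> on which the phase is constant and nonzero, fix a root cell, and let
\<open>X(K)\<close> consist of \<open>K\<close> and of all cells that \<open>K\<close> separates
from the root. These regions form a laminar family. A matching edge is never separated, and its
two cells have opposite colours; so the surplus stays the same when each cell, including those
of \<open>M\<close>, is given the phase of the innermost component whose region contains it, or
a fixed background sign if there is none. Up to the signed excess of the whole grid it becomes a
sum over the nested regions of twice the colour excess of \<open>X(K)\<close>, signed by the
phase of \<open>K\<close>, for those \<open>K\<close> whose phase differs from that of the next
region outside.

The heart of the proof is an isoperimetric inequality for one region
(\<open>excess_bound\<close>). At a convex corner of \<open>X(K)\<close> inside the grid there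
is a cell of \<open>K\<close> with two neighbours of another phase; by the condition on
\<open>T\<close> that cell is empty. Since the convex corners outweigh the reflex ones, as in
the Gauss--Bonnet formula, this makes the signed excess nonpositive unless the region contains
corners of the grid. The topology needed for this is a single elementary fact, that a connected
set of cells has Euler characteristic at most one (\<open>euler_conn_le_1\<close>); applied to a
region and its complement, it also replaces planarity arguments
(\<open>border_changes_le_2\<close>).

With a suitable root every region contains at most two corners of the grid, and only a region
that contains two corners of its own colour can contribute positively. If both sides are even
there is no such region, and the surplus is at most \<open>0\<close>. In the other cases such a
region cuts the grid from side to side, and its excess is at most that of its intersection with
one border line of, say, \<open>L\<close> cells. Therefore the surplus is at most what that line
carries; there the condition on \<open>T\<close> allows no three consecutive cells whose label
agrees with their colour, which gives the bound \<open>L - 2 (L div 3)\<close>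
(\<open>line_bound\<close>). This is exactly the value that belongs to \<open>F\<close>.
\<close>

section \<open>Cells, adjacency and connected sets\<close>

type_synonym cell = "nat \<times> nat"

definition rect :: "nat \<Rightarrow> nat \<Rightarrow> cell set" where
  "rect m n = {1..m} \<times> {1..n}"

definition adj :: "cell \<Rightarrow> cell \<Rightarrow> bool" where
  "adj c d \<longleftrightarrow>
     fst c = fst d \<and> (snd d = Suc (snd c) \<or> snd c = Suc (snd d)) \<or>
     snd c = snd d \<and> (fst d = Suc (fst c) \<or> fst c = Suc (fst d))"

text \<open>
The chessboard colouring with black cells worth \<open>1\<close> and white cells worth
\<open>-1\<close>; the corner \<open>(1, 1)\<close> is black.
\<close>

definition col :: "cell \<Rightarrow> int" where
  "col c = (if even (fst c + snd c) then 1 else -1)"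

lemma adj_sym: "adj c d \<Longrightarrow> adj d c"
  by (auto simp: adj_def)

lemma adj_irrefl: "\<not> adj c c"
  by (auto simp: adj_def)

lemma col_adj: "adj c d \<Longrightarrow> col d = - col c"
  by (auto simp: adj_def col_def)

lemma col_cases: "col c = 1 \<or> col c = -1"
  by (simp add: col_def)

lemma finite_rect: "finite (rect m n)"
  by (simp add: rect_def)

lemma mem_rect: "(i, j) \<in> rect m n \<longleftrightarrow> 1 \<le> i \<and> i \<le> m \<and> 1 \<le> j \<and> j \<le> n"
  by (auto simp: rect_def)

definition reach :: "cell set \<Rightarrow> (cell \<times> cell) set" where
  "reach S = {(x, y). x \<in> S \<and> y \<in> S \<and> adj x y}\<^sup>*"

definition conn :: "cell set \<Rightarrow> bool" where
  "conn S \<longleftrightarrow> (\<forall>x\<in>S. \<forall>y\<in>S. (x, y) \<in> reach S)"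

lemma reach_refl: "(x, x) \<in> reach S"
  by (simp add: reach_def)

lemma reach_trans: "(x, y) \<in> reach S \<Longrightarrow> (y, z) \<in> reach S \<Longrightarrow> (x, z) \<in> reach S"
  unfolding reach_def by (rule rtrancl_trans)

lemma reach_step: "x \<in> S \<Longrightarrow> y \<in> S \<Longrightarrow> adj x y \<Longrightarrow> (x, y) \<in> reach S"
  unfolding reach_def by (rule r_into_rtrancl) auto

lemma reach_sym: "(x, y) \<in> reach S \<Longrightarrow> (y, x) \<in> reach S"
proof -
  have "sym {(x, y). x \<in> S \<and> y \<in> S \<and> adj x y}"
    by (auto simp: sym_def intro: adj_sym)
  then show "(x, y) \<in> reach S \<Longrightarrow> (y, x) \<in> reach S"
    unfolding reach_def by (meson sym_rtrancl symE)
qed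

lemma reach_mono: "S \<subseteq> S' \<Longrightarrow> (x, y) \<in> reach S \<Longrightarrow> (x, y) \<in> reach S'"
  unfolding reach_def by (rule rtrancl_mono[THEN subsetD]) auto

lemma reach_label:
  assumes "(x, y) \<in> reach S"
    and "\<And>x y. x \<in> S \<Longrightarrow> y \<in> S \<Longrightarrow> adj x y \<Longrightarrow> f x = f y"
  shows "f x = f y"
  using assms(1) unfolding reach_def
  by (induction rule: rtrancl_induct) (auto intro: assms(2))

lemma reach_in:
  assumes "(x, y) \<in> reach S" "x \<in> S"
  shows "y \<in> S"
  using assms unfolding reach_def by (induction rule: rtrancl_induct) auto

section \<open>The Euler characteristic of a set of cells\<close>

text \<open>
The number of cells, minus the number of adjacent pairs, plus the number of full two-by-two
squares: each pair and each square is charged to its cell with the smallest coordinates.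
\<close>

definition euler :: "cell set \<Rightarrow> int" where
  "euler S = (\<Sum>(i, j)\<in>S. 1 - of_bool ((i, Suc j) \<in> S) - of_bool ((Suc i, j) \<in> S)
     + of_bool ((i, Suc j) \<in> S \<and> (Suc i, j) \<in> S \<and> (Suc i, Suc j) \<in> S))"

lemma card_merge:
  assumes "finite A"
  shows "card A \<le> Suc (card ((\<lambda>x. if x = a then b else x) ` A))"
proof -
  have "A - {a} \<subseteq> (\<lambda>x. if x = a then b else x) ` A" by (auto simp: image_iff)
  then have "card (A - {a}) \<le> card ((\<lambda>x. if x = a then b else x) ` A)"
    by (intro card_mono) (use assms in auto)
  then show ?thesis using card_Suc_Diff1[OF assms, of a] by (cases "a \<in> A") auto
qed

text \<open>
The image of a function that is constant along adjacencies counts at most the connected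
components, so this says that the Euler characteristic is at most the number of components,
without ever forming the components. Cells are added by decreasing coordinate sum, so that a new
cell meets at most its right and its lower neighbour. Meeting both lowers the characteristic by
one, which pays for the merging of their labels; if the diagonal cell is present as well, then
the characteristic does not change, but the two neighbours already carried the same label.
\<close>

lemma euler_labelling:
  assumes "finite S"
  shows "\<exists>f :: cell \<Rightarrow> nat. (\<forall>x\<in>S. \<forall>y\<in>S. adj x y \<longrightarrow> f x = f y) \<and> euler S \<le> int (card (f ` S))"
  using assms
proof (induction rule: finite_ranking_induct[where f = "\<lambda>c. - int (fst c + snd c)"])
  case empty
  show ?case by (simp add: euler_def)
next
  case (insert c S)
  show ?case
  proof (cases "c \<in> S")
    case True
    then show ?thesis using insert.IH by (simp add: insert_absorb)
  next
    case False
    obtain i j where c: "c = (i, j)" by (cases c)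
    have ge: "i + j \<le> a + b" if "(a, b) \<in> S" for a b
      using insert.hyps(2)[OF that] by (simp add: c)
    define R D Q where "R \<longleftrightarrow> (i, Suc j) \<in> S" and "D \<longleftrightarrow> (Suc i, j) \<in> S" and "Q \<longleftrightarrow> (Suc i, Suc j) \<in> S"
    obtain f :: "cell \<Rightarrow> nat" where
      f: "\<And>x y. x \<in> S \<Longrightarrow> y \<in> S \<Longrightarrow> adj x y \<Longrightarrow> f x = f y" "euler S \<le> int (card (f ` S))"
      using insert.IH by blast
    have eul: "euler (insert c S) = 1 - of_bool R - of_bool D + of_bool (R \<and> D \<and> Q) + euler S"
    proof -
      have "euler (insert c S) =
          (1 - of_bool ((i, Suc j) \<in> insert c S) - of_bool ((Suc i, j) \<in> insert c S)
            + of_bool ((i, Suc j) \<in> insert c S \<and> (Suc i, j) \<in> insert c S \<and> (Suc i, Suc j) \<in> insert c S))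
          + (\<Sum>(i, j)\<in>S. 1 - of_bool ((i, Suc j) \<in> insert c S) - of_bool ((Suc i, j) \<in> insert c S)
            + of_bool ((i, Suc j) \<in> insert c S \<and> (Suc i, j) \<in> insert c S \<and> (Suc i, Suc j) \<in> insert c S))"
        unfolding euler_def using False insert.hyps(1) by (simp add: c)
      also have "(\<Sum>(i, j)\<in>S. 1 - of_bool ((i, Suc j) \<in> insert c S) - of_bool ((Suc i, j) \<in> insert c S)
            + of_bool ((i, Suc j) \<in> insert c S \<and> (Suc i, j) \<in> insert c S \<and> (Suc i, Suc j) \<in> insert c S))
          = euler S"
        unfolding euler_def
      proof (rule sum.cong[OF refl], clarify)
        fix a b assume "(a, b) \<in> S"
        from ge[OF this] have "(a, Suc b) \<noteq> c" "(Suc a, b) \<noteq> c" "(Suc a, Suc b) \<noteq> c"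
          by (auto simp: c)
        then show "(1::int) - of_bool ((a, Suc b) \<in> insert c S) - of_bool ((Suc a, b) \<in> insert c S)
            + of_bool ((a, Suc b) \<in> insert c S \<and> (Suc a, b) \<in> insert c S \<and> (Suc a, Suc b) \<in> insert c S)
          = 1 - of_bool ((a, Suc b) \<in> S) - of_bool ((Suc a, b) \<in> S)
            + of_bool ((a, Suc b) \<in> S \<and> (Suc a, b) \<in> S \<and> (Suc a, Suc b) \<in> S)" by simp
      qed
      finally show ?thesis by (simp add: c R_def D_def Q_def)
    qed
    have nb: "x = (i, Suc j) \<or> x = (Suc i, j)" if "x \<in> S" "adj c x \<or> adj x c" for x
      using that ge[of "fst x" "snd x"] by (cases x) (auto simp: c adj_def)
    show ?thesis
    proof (cases "R \<and> D \<and> \<not> Q")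
      case True
      define h where "h = (\<lambda>x. if x = f (Suc i, j) then f (i, Suc j) else x)"
      define g where "g = (\<lambda>x. if x = c then f (i, Suc j) else h (f x))"
      have "g x = g y" if "x \<in> insert c S" "y \<in> insert c S" "adj x y" for x y
        using that nb[of x] nb[of y] f(1)[of x y] False adj_irrefl[of c]
        by (auto simp: g_def h_def)
      moreover have "euler (insert c S) \<le> int (card (g ` insert c S))"
      proof -
        have "g ` S = h ` f ` S" using False by (auto simp: g_def image_iff)
        moreover have "card (f ` S) \<le> Suc (card (h ` f ` S))"
          unfolding h_def by (rule card_merge) (use insert.hyps in auto)
        moreover have "card (g ` S) \<le> card (g ` insert c S)"
          by (intro card_mono) (use insert.hyps in auto)
        ultimately show ?thesis using eul f(2) True by simp
      qed
      ultimately show ?thesis by blast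
    next
      case nT: False
      show ?thesis
      proof (cases "R \<or> D")
        case True
        define g where "g = (\<lambda>x. if x = c then (if R then f (i, Suc j) else f (Suc i, j)) else f x)"
        have RD: "f (i, Suc j) = f (Suc i, j)" if "R" "D"
        proof -
          have "Q" using nT that by blast
          then have "f (i, Suc j) = f (Suc i, Suc j)" "f (Suc i, j) = f (Suc i, Suc j)"
            using that f(1)[of "(i, Suc j)" "(Suc i, Suc j)"] f(1)[of "(Suc i, j)" "(Suc i, Suc j)"]
            by (simp_all add: R_def D_def Q_def adj_def)
          then show ?thesis by simp
        qed
        have "g x = g y" if "x \<in> insert c S" "y \<in> insert c S" "adj x y" for x y
          using that nb[of x] nb[of y] f(1)[of x y] False adj_irrefl[of c] RD
          by (auto simp: g_def R_def D_def)
        moreover have "euler (insert c S) \<le> int (card (g ` insert c S))"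
        proof -
          have "g ` S = f ` S" using False by (auto simp: g_def image_iff)
          then have 1: "card (f ` S) \<le> card (g ` insert c S)"
            by (metis card_mono finite_imageI finite_insert image_mono insert.hyps(1) subset_insertI)
          have 2: "euler (insert c S) \<le> euler S"
            using True by (cases R; cases D; cases Q) (auto simp: eul)
          show ?thesis using 1 2 f(2) by simp
        qed
        ultimately show ?thesis by blast
      next
        case no: False
        obtain k where k: "k \<notin> f ` S" using insert.hyps(1) ex_new_if_finite[of "f ` S"] by auto
        define g where "g = (\<lambda>x. if x = c then k else f x)"
        have "g x = g y" if "x \<in> insert c S" "y \<in> insert c S" "adj x y" for x y
          using that nb[of x] nb[of y] f(1)[of x y] False adj_irrefl[of c] no
          by (auto simp: g_def R_def D_def)
        moreover have "euler (insert c S) \<le> int (card (g ` insert c S))"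
        proof -
          have "g ` insert c S = insert k (f ` S)" using False by (auto simp: g_def image_iff)
          then have "card (g ` insert c S) = Suc (card (f ` S))" using k insert.hyps by simp
          then show ?thesis using eul f(2) no by simp
        qed
        ultimately show ?thesis by blast
      qed
    qed
  qed
qed

lemma euler_conn_le_1:
  assumes "finite S" "conn S"
  shows "euler S \<le> 1"
proof -
  obtain f :: "cell \<Rightarrow> nat" where
    f: "\<forall>x\<in>S. \<forall>y\<in>S. adj x y \<longrightarrow> f x = f y" and le: "euler S \<le> int (card (f ` S))"
    using euler_labelling[OF assms(1)] by (elim exE conjE)
  have "f x = f y" if "x \<in> S" "y \<in> S" for x y
  proof -
    have "(x, y) \<in> reach S" using that assms(2) by (simp add: conn_def)
    then show ?thesis by (rule reach_label) (use f in blast)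
  qed
  then have "\<forall>a\<in>f ` S. \<forall>b\<in>f ` S. a = b" by blast
  then have "card (f ` S) \<le> Suc 0"
    using card_le_Suc0_iff_eq[of "f ` S"] assms(1) by blast
  then show ?thesis using le by linarith
qed

section \<open>Summation over windows of two by two cells\<close>

definition ind :: "cell set \<Rightarrow> nat \<Rightarrow> nat \<Rightarrow> int" where
  "ind S i j = of_bool ((i, j) \<in> S)"

text \<open>
Corners of \<open>S\<close> seen in the window with least cell \<open>(i, j)\<close>: a convex
corner counts \<open>1\<close>, a reflex corner \<open>-1\<close>, two diagonally opposite cells
\<open>2\<close>, everything else \<open>0\<close>. This is a discrete curvature, and
\<open>sum_kappa\<close> is its Gauss--Bonnet formula. Windows are allowed to overhang the
rectangle.
\<close>

definition kappa :: "cell set \<Rightarrow> nat \<Rightarrow> nat \<Rightarrow> int" where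
  "kappa S i j =
     ind S i j + ind S i (Suc j) + ind S (Suc i) j + ind S (Suc i) (Suc j)
     - 2 * (ind S i j * ind S i (Suc j) + ind S (Suc i) j * ind S (Suc i) (Suc j)
          + ind S i j * ind S (Suc i) j + ind S i (Suc j) * ind S (Suc i) (Suc j))
     + 4 * (ind S i j * ind S i (Suc j) * ind S (Suc i) j * ind S (Suc i) (Suc j))"

definition excess :: "cell set \<Rightarrow> int" where
  "excess S = sum col S"

lemma sum_shift1:
  fixes f :: "nat \<Rightarrow> int"
  assumes "f 0 = 0" "f (Suc n) = 0"
  shows "(\<Sum>j\<le>n. f (Suc j)) = (\<Sum>j\<le>n. f j)"
  using sum.atMost_Suc_shift[of f n] sum.atMost_Suc[of f n] assms by simp

lemma ind_border:
  assumes "S \<subseteq> rect m n"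
  shows "ind S 0 j = 0" "ind S i 0 = 0" "ind S (Suc m) j = 0" "ind S i (Suc n) = 0"
  using assms by (auto simp: ind_def mem_rect dest: subsetD)

lemma sum_shift_cols:
  fixes f :: "nat \<Rightarrow> nat \<Rightarrow> int"
  assumes "\<And>i. f i 0 = 0" "\<And>i. f i (Suc n) = 0"
  shows "(\<Sum>i\<le>m. \<Sum>j\<le>n. f i (Suc j)) = (\<Sum>i\<le>m. \<Sum>j\<le>n. f i j)"
  by (intro sum.cong refl sum_shift1 assms)

lemma sum_shift_rows:
  fixes f :: "nat \<Rightarrow> nat \<Rightarrow> int"
  assumes "\<And>j. f 0 j = 0" "\<And>j. f (Suc m) j = 0"
  shows "(\<Sum>i\<le>m. \<Sum>j\<le>n. f (Suc i) j) = (\<Sum>i\<le>m. \<Sum>j\<le>n. f i j)"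
  using sum_shift1[of "\<lambda>i. \<Sum>j\<le>n. f i j" m] assms by simp

lemma sum_over_rect:
  fixes g :: "cell \<Rightarrow> int"
  assumes "S \<subseteq> rect m n"
  shows "sum g S = (\<Sum>i\<le>m. \<Sum>j\<le>n. ind S i j * g (i, j))"
proof -
  have "(\<Sum>i\<le>m. \<Sum>j\<le>n. ind S i j * g (i, j)) = (\<Sum>c\<in>{..m} \<times> {..n}. of_bool (c \<in> S) * g c)"
    unfolding sum.cartesian_product ind_def by (rule sum.cong) auto
  also have "\<dots> = (\<Sum>c\<in>S. of_bool (c \<in> S) * g c)"
    using assms by (intro sum.mono_neutral_right) (auto simp: rect_def)
  finally show ?thesis by simp
qed

lemma sum_kappa:
  assumes S: "S \<subseteq> rect m n"
  shows "(\<Sum>i\<le>m. \<Sum>j\<le>n. kappa S i j) = 4 * euler S"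
proof -
  let ?G = "\<lambda>f :: nat \<Rightarrow> nat \<Rightarrow> int. \<Sum>i\<le>m. \<Sum>j\<le>n. f i j"
  note b = ind_border[OF S]
  define a where "a = ind S"
  define H where "H = (\<lambda>i j. a i j * a i (Suc j))"
  define V where "V = (\<lambda>i j. a i j * a (Suc i) j)"
  define Q where "Q = (\<lambda>i j. a i j * a i (Suc j) * a (Suc i) j * a (Suc i) (Suc j))"
  have 1: "?G (\<lambda>i j. a i (Suc j)) = ?G a"
    by (rule sum_shift_cols) (simp_all add: a_def b)
  have 2: "?G (\<lambda>i j. a (Suc i) j) = ?G a"
    by (rule sum_shift_rows) (simp_all add: a_def b)
  have 3: "?G (\<lambda>i j. a (Suc i) (Suc j)) = ?G a"
    using sum_shift_rows[of "\<lambda>i j. a i (Suc j)" m n] 1 by (simp add: a_def b)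
  have 4: "?G (\<lambda>i j. H (Suc i) j) = ?G H"
    by (rule sum_shift_rows) (simp_all add: H_def a_def b)
  have 5: "?G (\<lambda>i j. V i (Suc j)) = ?G V"
    by (rule sum_shift_cols) (simp_all add: V_def a_def b)
  have e: "euler S = ?G (\<lambda>i j. a i j - H i j - V i j + Q i j)"
    unfolding euler_def sum_over_rect[OF S]
    by (intro sum.cong refl) (auto simp: a_def H_def V_def Q_def ind_def)
  have k: "kappa S i j = a i j + a i (Suc j) + a (Suc i) j + a (Suc i) (Suc j)
      - 2 * (H i j + H (Suc i) j + V i j + V i (Suc j)) + 4 * Q i j" for i j
    by (simp add: kappa_def a_def H_def V_def Q_def)
  have "?G (kappa S) = 4 * ?G a - 4 * ?G H - 4 * ?G V + 4 * ?G Q"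
    unfolding k using 1 2 3 4 5
    by (simp add: sum.distrib sum_subtractf flip: sum_distrib_left)
  also have "\<dots> = 4 * euler S"
    unfolding e by (simp add: sum.distrib sum_subtractf)
  finally show ?thesis .
qed

lemma sum_windows:
  fixes g :: "cell \<Rightarrow> int"
  assumes S: "S \<subseteq> rect m n"
  shows "(\<Sum>i\<le>m. \<Sum>j\<le>n. ind S i j * g (i, j) + ind S i (Suc j) * g (i, Suc j)
      + ind S (Suc i) j * g (Suc i, j) + ind S (Suc i) (Suc j) * g (Suc i, Suc j)) = 4 * sum g S"
proof -
  let ?G = "\<lambda>f :: nat \<Rightarrow> nat \<Rightarrow> int. \<Sum>i\<le>m. \<Sum>j\<le>n. f i j"
  note b = ind_border[OF S]
  define a where "a = (\<lambda>i j. ind S i j * g (i, j))"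
  have 1: "?G (\<lambda>i j. a i (Suc j)) = ?G a"
    by (rule sum_shift_cols) (simp_all add: a_def b)
  have 2: "?G (\<lambda>i j. a (Suc i) j) = ?G a"
    by (rule sum_shift_rows) (simp_all add: a_def b)
  have 3: "?G (\<lambda>i j. a (Suc i) (Suc j)) = ?G a"
    using sum_shift_rows[of "\<lambda>i j. a i (Suc j)" m n] 1 by (simp add: a_def b)
  show ?thesis
    using 1 2 3 unfolding sum_over_rect[OF S] by (simp add: a_def sum.distrib)
qed

lemma sum_ends:
  fixes f :: "nat \<Rightarrow> int"
  assumes "m \<ge> 1"
  shows "(\<Sum>i\<le>m. f i) = f 0 + f m + (\<Sum>i\<in>{1..<m}. f i)"
proof -
  have "{..m} = insert 0 (insert m {1..<m})" using assms by auto
  then show ?thesis using assms by simp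
qed

lemma sum_border:
  fixes w :: "nat \<Rightarrow> nat \<Rightarrow> int"
  assumes "m \<ge> 1" "n \<ge> 1"
  shows "(\<Sum>i\<le>m. \<Sum>j\<le>n. w i j) = w 0 0 + w 0 n + w m 0 + w m n
    + (\<Sum>j\<in>{1..<n}. w 0 j) + (\<Sum>j\<in>{1..<n}. w m j)
    + (\<Sum>i\<in>{1..<m}. w i 0) + (\<Sum>i\<in>{1..<m}. w i n)
    + (\<Sum>i\<in>{1..<m}. \<Sum>j\<in>{1..<n}. w i j)"
  by (simp add: sum_ends[OF assms(1)] sum_ends[OF assms(2)] sum.distrib)

lemma col_Suc: "col (Suc i, j) = - col (i, j)" "col (i, Suc j) = - col (i, j)"
  by (simp_all add: col_def)

definition mixed :: "cell set \<Rightarrow> cell \<Rightarrow> cell \<Rightarrow> int" where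
  "mixed X c d = of_bool ((c \<in> X) \<noteq> (d \<in> X))"

text \<open>
A substitute for the Jordan curve theorem: if a rectangle is split into two connected parts,
then the part changes at most twice along the border. Adding the curvatures of the two parts, an
inner window contributes at least \<open>0\<close>, a change along the border contributes
\<open>2\<close> and each of the four corner windows contributes \<open>1\<close>, while the
total is at most \<open>4 + 4\<close>.
\<close>

lemma border_changes_le_2:
  assumes mn: "m \<ge> 1" "n \<ge> 1" and X: "X \<subseteq> rect m n"
    and conn: "conn X" "conn (rect m n - X)"
  shows "(\<Sum>j\<in>{1..<n}. mixed X (1, j) (1, Suc j)) + (\<Sum>j\<in>{1..<n}. mixed X (m, j) (m, Suc j))
    + (\<Sum>i\<in>{1..<m}. mixed X (i, 1) (Suc i, 1)) + (\<Sum>i\<in>{1..<m}. mixed X (i, n) (Suc i, n)) \<le> 2"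
proof -
  define Z where "Z = rect m n - X"
  have Z: "Z \<subseteq> rect m n" by (auto simp: Z_def)
  have iz: "ind Z i j = of_bool ((i, j) \<in> rect m n) - of_bool ((i, j) \<in> X)" for i j
    using X by (auto simp: ind_def Z_def)
  have ix: "ind X i j = of_bool ((i, j) \<in> X)" for i j
    by (simp add: ind_def)
  define w where "w i j = kappa X i j + kappa Z i j" for i j
  have out: "(0, j) \<notin> X" "(i, 0) \<notin> X" "(Suc m, j) \<notin> X" "(i, Suc n) \<notin> X" for i j
    using X by (auto simp: mem_rect dest: subsetD)
  have fin: "finite X" "finite Z" using X Z finite_rect finite_subset by blast+
  have "(\<Sum>i\<le>m. \<Sum>j\<le>n. w i j) = 4 * euler X + 4 * euler Z"
    by (simp add: w_def sum.distrib sum_kappa[OF X] sum_kappa[OF Z])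
  also have "\<dots> \<le> 8"
    using euler_conn_le_1[OF fin(1) conn(1)] euler_conn_le_1[OF fin(2)] conn(2) by (simp add: Z_def)
  finally have le: "(\<Sum>i\<le>m. \<Sum>j\<le>n. w i j) \<le> 8" .
  have corner: "w 0 0 = 1" "w 0 n = 1" "w m 0 = 1" "w m n = 1"
    using mn by (simp_all add: w_def kappa_def out iz ix mem_rect)
  have top: "w 0 j = 2 * mixed X (1, j) (1, Suc j)" if "j \<in> {1..<n}" for j
    using mn that by (cases "(1, j) \<in> X"; cases "(1, Suc j) \<in> X")
      (auto simp: w_def kappa_def out iz ix mem_rect mixed_def)
  have bot: "w m j = 2 * mixed X (m, j) (m, Suc j)" if "j \<in> {1..<n}" for j
    using mn that by (cases "(m, j) \<in> X"; cases "(m, Suc j) \<in> X")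
      (auto simp: w_def kappa_def out iz ix mem_rect mixed_def)
  have left: "w i 0 = 2 * mixed X (i, 1) (Suc i, 1)" if "i \<in> {1..<m}" for i
    using mn that by (cases "(i, 1) \<in> X"; cases "(Suc i, 1) \<in> X")
      (auto simp: w_def kappa_def out iz ix mem_rect mixed_def)
  have right: "w i n = 2 * mixed X (i, n) (Suc i, n)" if "i \<in> {1..<m}" for i
    using mn that by (cases "(i, n) \<in> X"; cases "(Suc i, n) \<in> X")
      (auto simp: w_def kappa_def out iz ix mem_rect mixed_def)
  have inner: "0 \<le> w i j" if "i \<in> {1..<m}" "j \<in> {1..<n}" for i j
    using that unfolding w_def kappa_def iz ix
    by (cases "(i, j) \<in> X"; cases "(i, Suc j) \<in> X"; cases "(Suc i, j) \<in> X"; cases "(Suc i, Suc j) \<in> X")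
      (simp_all add: mem_rect)
  have "0 \<le> (\<Sum>i\<in>{1..<m}. \<Sum>j\<in>{1..<n}. w i j)"
    by (intro sum_nonneg inner)
  then show ?thesis
    using le unfolding sum_border[OF mn] corner
    by (simp add: top bot left right flip: sum_distrib_left)
qed

text \<open>
Below, \<open>e = 1\<close> makes black the favoured colour and \<open>e = -1\<close> makes
white the favoured colour. An end of \<open>X\<close> on the border is bad if its last cell has
the other colour.
\<close>

definition bad_end :: "cell set \<Rightarrow> int \<Rightarrow> cell \<Rightarrow> cell \<Rightarrow> int" where
  "bad_end X e c d = of_bool (c \<in> X \<and> d \<notin> X \<and> e * col c = -1) + of_bool (d \<in> X \<and> c \<notin> X \<and> e * col d = -1)"

lemma bad_end_nonneg: "0 \<le> bad_end X e c d"
  by (simp add: bad_end_def)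

definition own :: "cell set \<Rightarrow> int \<Rightarrow> cell \<Rightarrow> int" where
  "own X e c = of_bool (c \<in> X \<and> e * col c = 1)"

text \<open>
The isoperimetric inequality behind everything that follows. The hypothesis
\<open>convex\<close> forces every convex corner of \<open>X\<close> inside the rectangle to
have the unfavoured colour. Compare, window by window, \<open>e\<close> times the colour sum of
\<open>X\<close> with the curvature of the complement. In an inner window a single cell of
\<open>X\<close> contributes \<open>-1\<close> to both, three cells of \<open>X\<close>
contribute at most \<open>1\<close> against \<open>1\<close>, and two cells contribute at most
the curvature. So a surplus of the favoured colour can only come from the border, namely from
the corners of the rectangle, and each bad end lowers it. The total curvature of the complement
is at most \<open>4\<close> because it is connected.
\<close>

lemma excess_bound:
  assumes mn: "m \<ge> 1" "n \<ge> 1" and X: "X \<subseteq> rect m n"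
    and conn: "conn (rect m n - X)"
    and e: "e = 1 \<or> e = -1"
    and convex: "\<And>c d d'. c \<in> X \<Longrightarrow> d \<in> rect m n - X \<Longrightarrow> d' \<in> rect m n - X \<Longrightarrow> d \<noteq> d' \<Longrightarrow>
      adj c d \<Longrightarrow> adj c d' \<Longrightarrow> e * col c = -1"
  shows "2 * (e * excess X) + (\<Sum>j\<in>{1..<n}. bad_end X e (1, j) (1, Suc j))
      + (\<Sum>i\<in>{1..<m}. bad_end X e (i, 1) (Suc i, 1))
    \<le> own X e (1, 1) + own X e (1, n) + own X e (m, 1) + own X e (m, n)"
proof -
  define Z where "Z = rect m n - X"
  have Z: "Z \<subseteq> rect m n" by (auto simp: Z_def)
  have iz: "ind Z i j = of_bool ((i, j) \<in> rect m n) - of_bool ((i, j) \<in> X)" for i j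
    using X by (auto simp: ind_def Z_def)
  have ix: "ind X i j = of_bool ((i, j) \<in> X)" for i j
    by (simp add: ind_def)
  have eq: "e * col c = 1 \<or> e * col c = -1" for c using e col_cases[of c] by auto
  define s where "s i j = e * (ind X i j * col (i, j) + ind X i (Suc j) * col (i, Suc j)
      + ind X (Suc i) j * col (Suc i, j) + ind X (Suc i) (Suc j) * col (Suc i, Suc j))" for i j
  define w where "w i j = kappa Z i j - s i j" for i j
  have out: "(0, j) \<notin> X" "(i, 0) \<notin> X" "(Suc m, j) \<notin> X" "(i, Suc n) \<notin> X" for i j
    using X by (auto simp: mem_rect dest: subsetD)
  have fin: "finite Z" using Z finite_rect finite_subset by blast
  have "(\<Sum>i\<le>m. \<Sum>j\<le>n. s i j) = e * (4 * excess X)"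
    unfolding s_def excess_def sum_windows[OF X, symmetric] by (simp add: sum_distrib_left)
  then have "(\<Sum>i\<le>m. \<Sum>j\<le>n. w i j) = 4 * euler Z - 4 * (e * excess X)"
    by (simp add: w_def sum_subtractf sum_kappa[OF Z])
  also have "\<dots> \<le> 4 - 4 * (e * excess X)"
    using euler_conn_le_1[OF fin] conn by (simp add: Z_def)
  finally have le: "(\<Sum>i\<le>m. \<Sum>j\<le>n. w i j) \<le> 4 - 4 * (e * excess X)" .
  have c1: "w 0 0 = 1 - 2 * own X e (1, 1)"
    using mn eq[of "(1, 1)"] by (cases "(1, 1) \<in> X") (auto simp: w_def s_def kappa_def out iz ix mem_rect own_def)
  have c2: "w 0 n = 1 - 2 * own X e (1, n)"
    using mn eq[of "(1, n)"] by (cases "(1, n) \<in> X") (auto simp: w_def s_def kappa_def out iz ix mem_rect own_def)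
  have c3: "w m 0 = 1 - 2 * own X e (m, 1)"
    using mn eq[of "(m, 1)"] by (cases "(m, 1) \<in> X") (auto simp: w_def s_def kappa_def out iz ix mem_rect own_def)
  have c4: "w m n = 1 - 2 * own X e (m, n)"
    using mn eq[of "(m, n)"] by (cases "(m, n) \<in> X") (auto simp: w_def s_def kappa_def out iz ix mem_rect own_def)
  have top: "w 0 j = 2 * bad_end X e (1, j) (1, Suc j)" if "j \<in> {1..<n}" for j
    using mn that eq[of "(1, j)"]
    by (cases "(1, j) \<in> X"; cases "(1, Suc j) \<in> X")
      (auto simp: w_def s_def kappa_def out iz ix mem_rect bad_end_def col_Suc)
  have bot: "w m j = 2 * bad_end X e (m, j) (m, Suc j)" if "j \<in> {1..<n}" for j
    using mn that eq[of "(m, j)"]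
    by (cases "(m, j) \<in> X"; cases "(m, Suc j) \<in> X")
      (auto simp: w_def s_def kappa_def out iz ix mem_rect bad_end_def col_Suc)
  have left: "w i 0 = 2 * bad_end X e (i, 1) (Suc i, 1)" if "i \<in> {1..<m}" for i
    using mn that eq[of "(i, 1)"]
    by (cases "(i, 1) \<in> X"; cases "(Suc i, 1) \<in> X")
      (auto simp: w_def s_def kappa_def out iz ix mem_rect bad_end_def col_Suc)
  have right: "w i n = 2 * bad_end X e (i, n) (Suc i, n)" if "i \<in> {1..<m}" for i
    using mn that eq[of "(i, n)"]
    by (cases "(i, n) \<in> X"; cases "(Suc i, n) \<in> X")
      (auto simp: w_def s_def kappa_def out iz ix mem_rect bad_end_def col_Suc)
  have inner: "0 \<le> w i j" if ij: "i \<in> {1..<m}" "j \<in> {1..<n}" for i j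
  proof -
    let ?a = "(i, j)" and ?b = "(i, Suc j)" and ?c = "(Suc i, j)" and ?d = "(Suc i, Suc j)"
    have r: "?a \<in> rect m n" "?b \<in> rect m n" "?c \<in> rect m n" "?d \<in> rect m n"
      using ij by (auto simp: mem_rect)
    have "?a \<in> X \<Longrightarrow> ?b \<notin> X \<Longrightarrow> ?c \<notin> X \<Longrightarrow> e * col ?a = -1"
      "?b \<in> X \<Longrightarrow> ?a \<notin> X \<Longrightarrow> ?d \<notin> X \<Longrightarrow> e * col ?b = -1"
      "?c \<in> X \<Longrightarrow> ?a \<notin> X \<Longrightarrow> ?d \<notin> X \<Longrightarrow> e * col ?c = -1"
      "?d \<in> X \<Longrightarrow> ?b \<notin> X \<Longrightarrow> ?c \<notin> X \<Longrightarrow> e * col ?d = -1"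
      using r by (auto intro: convex[of ?a ?b ?c] convex[of ?b ?a ?d] convex[of ?c ?a ?d] convex[of ?d ?b ?c]
          simp: adj_def)
    then show ?thesis
      using eq[of ?a] r
      unfolding w_def s_def kappa_def iz ix
      by (cases "?a \<in> X"; cases "?b \<in> X"; cases "?c \<in> X"; cases "?d \<in> X")
        (auto simp: col_Suc)
  qed
  have "0 \<le> (\<Sum>i\<in>{1..<m}. \<Sum>j\<in>{1..<n}. w i j)"
    by (intro sum_nonneg inner)
  moreover have "0 \<le> (\<Sum>j\<in>{1..<n}. bad_end X e (m, j) (m, Suc j))"
    "0 \<le> (\<Sum>i\<in>{1..<m}. bad_end X e (i, n) (Suc i, n))"
    by (intro sum_nonneg bad_end_nonneg)+
  ultimately show ?thesis
    using le unfolding sum_border[OF mn] c1 c2 c3 c4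
    by (simp add: top bot left right flip: sum_distrib_left)
qed

section \<open>What a connected set cuts off from a root\<close>

definition outer :: "nat \<Rightarrow> nat \<Rightarrow> cell \<Rightarrow> cell set \<Rightarrow> cell set" where
  "outer m n r K = {c. (r, c) \<in> reach (rect m n - K)}"

definition inner :: "nat \<Rightarrow> nat \<Rightarrow> cell \<Rightarrow> cell set \<Rightarrow> cell set" where
  "inner m n r K = rect m n - outer m n r K"

lemma outer_subset: "r \<in> rect m n - K \<Longrightarrow> outer m n r K \<subseteq> rect m n - K"
  unfolding outer_def using reach_in by blast

lemma root_in_outer: "r \<in> outer m n r K"
  by (simp add: outer_def reach_refl)

lemma inner_subset: "inner m n r K \<subseteq> rect m n"
  by (auto simp: inner_def)

lemma subset_inner: "r \<in> rect m n - K \<Longrightarrow> K \<subseteq> rect m n \<Longrightarrow> K \<subseteq> inner m n r K"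
  using outer_subset[of r m n K] by (auto simp: inner_def)

lemma rect_minus_inner: "r \<in> rect m n - K \<Longrightarrow> rect m n - inner m n r K = outer m n r K"
  using outer_subset[of r m n K] by (auto simp: inner_def)

lemma inner_boundary:
  assumes "r \<in> rect m n - K" "c \<in> inner m n r K" "d \<in> outer m n r K" "adj c d"
  shows "c \<in> K"
proof (rule ccontr)
  assume "c \<notin> K"
  then have "c \<in> rect m n - K" "d \<in> rect m n - K"
    using assms outer_subset[of r m n K] by (auto simp: inner_def)
  then have "(d, c) \<in> reach (rect m n - K)" using assms(4) by (auto intro: reach_step adj_sym)
  then have "c \<in> outer m n r K" using assms(3) by (auto simp: outer_def intro: reach_trans)
  then show False using assms(2) by (simp add: inner_def)
qed

lemma reach_component:
  assumes "(x, y) \<in> reach S"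
  shows "(x, y) \<in> reach {c. (x, c) \<in> reach S}"
  using assms unfolding reach_def[of S]
proof (induction rule: rtrancl_induct)
  case base
  show ?case by (rule reach_refl)
next
  case (step y z)
  then have "(x, y) \<in> reach S" "(x, z) \<in> reach S" "adj y z"
    unfolding reach_def by (auto intro: rtrancl_into_rtrancl)
  then have "(y, z) \<in> reach {c. (x, c) \<in> reach S}" by (auto intro: reach_step)
  with step.IH show ?case unfolding reach_def[of S, symmetric] by (rule reach_trans)
qed

lemma conn_component: "conn {c. (x, c) \<in> reach S}"
  unfolding conn_def
proof (intro ballI)
  fix y z assume "y \<in> {c. (x, c) \<in> reach S}" "z \<in> {c. (x, c) \<in> reach S}"
  then have "(x, y) \<in> reach {c. (x, c) \<in> reach S}" "(x, z) \<in> reach {c. (x, c) \<in> reach S}"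
    by (auto intro: reach_component)
  then show "(y, z) \<in> reach {c. (x, c) \<in> reach S}" by (meson reach_sym reach_trans)
qed

lemma conn_outer: "conn (outer m n r K)"
  unfolding outer_def by (rule conn_component)

lemma conn_subset_outer:
  assumes "conn L" "L \<subseteq> rect m n - K" "x \<in> L" "x \<in> outer m n r K"
  shows "L \<subseteq> outer m n r K"
proof
  fix y assume "y \<in> L"
  then have "(x, y) \<in> reach L" using assms by (auto simp: conn_def)
  then have "(x, y) \<in> reach (rect m n - K)" by (rule reach_mono[OF assms(2)])
  then show "y \<in> outer m n r K" using assms(4) reach_trans[of r x _ y] by (simp add: outer_def)
qed

lemma conn_cases:
  assumes "conn L" "L \<subseteq> rect m n - K"
  shows "L \<subseteq> outer m n r K \<or> L \<subseteq> inner m n r K"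
proof (cases "L \<inter> outer m n r K = {}")
  case True
  then show ?thesis using assms(2) by (auto simp: inner_def)
next
  case False
  then show ?thesis using conn_subset_outer[OF assms] by blast
qed

lemma conn_rect: "conn (rect m n)"
proof -
  have row: "((1, 1), (1, Suc j)) \<in> reach (rect m n)" if "Suc j \<le> n" "1 \<le> m" for j
    using that
  proof (induction j)
    case 0
    show ?case by (simp add: reach_refl)
  next
    case (Suc j)
    then have "((1, Suc j), (1, Suc (Suc j))) \<in> reach (rect m n)"
      by (intro reach_step) (auto simp: mem_rect adj_def)
    with Suc show ?case using reach_trans by auto
  qed
  have all: "((1, 1), (Suc i, Suc j)) \<in> reach (rect m n)" if "Suc i \<le> m" "Suc j \<le> n" for i j
    using that
  proof (induction i)
    case 0
    then show ?case using row[of j] by simp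
  next
    case (Suc i)
    then have "((Suc i, Suc j), (Suc (Suc i), Suc j)) \<in> reach (rect m n)"
      by (intro reach_step) (auto simp: mem_rect adj_def)
    with Suc show ?case using reach_trans by auto
  qed
  have "((1, 1), c) \<in> reach (rect m n)" if "c \<in> rect m n" for c
    using that all[of "fst c - 1" "snd c - 1"] by (cases c) (auto simp: mem_rect)
  then show ?thesis unfolding conn_def by (meson reach_sym reach_trans)
qed

text \<open>
On the way from a cell of the region to \<open>K\<close>, the region can only be left through
\<open>K\<close>, and from there on one may walk inside the connected set \<open>K\<close>.
\<close>

lemma conn_inner:
  assumes r: "r \<in> rect m n - K" and K: "conn K" "K \<subseteq> rect m n" "K \<noteq> {}"
  shows "conn (inner m n r K)"
proof -
  obtain k where k: "k \<in> K" using K by auto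
  have sub: "K \<subseteq> inner m n r K" by (rule subset_inner[OF r K(2)])
  have "x \<in> inner m n r K \<longrightarrow> (x, k) \<in> reach (inner m n r K)" if "(x, k) \<in> reach (rect m n)" for x
    using that unfolding reach_def[of "rect m n"]
  proof (induction rule: converse_rtrancl_induct)
    case base
    show ?case by (simp add: reach_refl)
  next
    case (step x y)
    then have xy: "x \<in> rect m n" "y \<in> rect m n" "adj x y" by auto
    show ?case
    proof
      assume x: "x \<in> inner m n r K"
      show "(x, k) \<in> reach (inner m n r K)"
      proof (cases "y \<in> inner m n r K")
        case True
        then have "(y, k) \<in> reach (inner m n r K)" using step.IH by blast
        then show ?thesis by (rule reach_trans[OF reach_step[OF x True xy(3)]])
      next
        case False
        then have "y \<in> outer m n r K" using xy by (simp add: inner_def)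
        then have "x \<in> K" using inner_boundary[OF r x _ xy(3)] by blast
        then have "(x, k) \<in> reach K" using k K(1) unfolding conn_def by blast
        then show ?thesis by (rule reach_mono[OF sub])
      qed
    qed
  qed
  moreover have "(x, k) \<in> reach (rect m n)" if "x \<in> inner m n r K" for x
    using conn_rect[of m n] that k K(2) inner_subset[of m n r K] unfolding conn_def by blast
  ultimately have "(x, k) \<in> reach (inner m n r K)" if "x \<in> inner m n r K" for x
    using that by blast
  then show ?thesis unfolding conn_def by (meson reach_sym reach_trans)
qed

lemma boundary_exists:
  assumes r: "r \<in> rect m n - K" and K: "conn K" "K \<subseteq> rect m n" "K \<noteq> {}"
  shows "\<exists>c\<in>K. \<exists>d\<in>outer m n r K. adj c d"
proof (rule ccontr)
  assume no: "\<not> ?thesis"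
  obtain k where k: "k \<in> K" using K by auto
  have "(r, k) \<in> reach (rect m n)" using conn_rect[of m n] r k K(2) unfolding conn_def by blast
  then have "(r \<in> outer m n r K) = (k \<in> outer m n r K)"
  proof (rule reach_label)
    fix x y assume xy: "x \<in> rect m n" "y \<in> rect m n" "adj x y"
    show "(x \<in> outer m n r K) = (y \<in> outer m n r K)"
      using no xy inner_boundary[OF r, of x y] inner_boundary[OF r, of y x] adj_sym[of x y]
      by (auto simp: inner_def)
  qed
  then show False using outer_subset[OF r] k root_in_outer by blast
qed

lemma inner_mono:
  assumes r: "r \<in> rect m n - K" "r \<in> rect m n - K'"
    and K: "conn K" "K \<subseteq> rect m n" "K \<noteq> {}" and K': "K' \<subseteq> rect m n" and dis: "K \<inter> K' = {}"
    and sub: "K' \<subseteq> inner m n r K"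
  shows "inner m n r K' \<subseteq> inner m n r K" "K \<subseteq> outer m n r K'"
proof -
  have "outer m n r K \<subseteq> rect m n - K'"
    using outer_subset[OF r(1)] sub by (auto simp: inner_def)
  then have 1: "outer m n r K \<subseteq> outer m n r K'"
    using conn_subset_outer[OF conn_outer _ root_in_outer root_in_outer] by blast
  then show "inner m n r K' \<subseteq> inner m n r K" by (auto simp: inner_def)
  obtain c d where cd: "c \<in> K" "d \<in> outer m n r K" "adj c d"
    using boundary_exists[OF r(1) K] by blast
  have "c \<in> outer m n r K'"
  proof (rule ccontr)
    assume "c \<notin> outer m n r K'"
    then have "c \<in> inner m n r K'" using cd K by (auto simp: inner_def)
    then have "c \<in> K'" using inner_boundary[OF r(2) _ _ cd(3)] cd 1 by blast
    then show False using cd dis by blast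
  qed
  then show "K \<subseteq> outer m n r K'"
    using conn_subset_outer[OF K(1) _ cd(1)] K dis by blast
qed

text \<open>
If neither set lies in the region of the other, then each lies outside the region of the other;
the region of \<open>K\<close> is connected, avoids \<open>K'\<close> and meets the outside of
\<open>K'\<close>, so it lies there entirely.
\<close>

lemma inner_laminar:
  assumes r: "r \<in> rect m n - K" "r \<in> rect m n - K'"
    and K: "conn K" "K \<subseteq> rect m n" "K \<noteq> {}" and K': "conn K'" "K' \<subseteq> rect m n" "K' \<noteq> {}"
    and dis: "K \<inter> K' = {}"
  shows "K' \<subseteq> inner m n r K \<or> K \<subseteq> inner m n r K' \<or> inner m n r K \<inter> inner m n r K' = {}"
proof (rule ccontr)
  assume no: "\<not> ?thesis"
  have "K' \<subseteq> outer m n r K" using conn_cases[OF K'(1), of m n K r] K' dis no by blast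
  then have d: "inner m n r K \<subseteq> rect m n - K'" by (auto simp: inner_def)
  have "K \<subseteq> outer m n r K'" using conn_cases[OF K(1), of m n K' r] K dis no by blast
  then have "inner m n r K \<subseteq> outer m n r K'"
    using conn_subset_outer[OF conn_inner[OF r(1) K] d] subset_inner[OF r(1) K(2)] K(3) by blast
  then show False using no by (auto simp: inner_def)
qed

section \<open>Painting a laminar family of regions\<close>

text \<open>
Each set \<open>K\<close> of the list paints its region \<open>X K\<close> with the sign \<open>s K\<close>, over a background of sign \<open>e\<close>.
The head of the list is painted last, so inner regions stand before the regions that contain them.
\<close>

primrec paint :: "(cell set \<Rightarrow> cell set) \<Rightarrow> (cell set \<Rightarrow> int) \<Rightarrow> int \<Rightarrow> cell set list \<Rightarrow> cell \<Rightarrow> int" where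
  "paint X s e [] c = e"
| "paint X s e (K # Ks) c = (if c \<in> X K then s K else paint X s e Ks c)"

lemma paint_outside: "(\<And>K. K \<in> set Ks \<Longrightarrow> c \<notin> X K) \<Longrightarrow> paint X s e Ks c = e"
  by (induction Ks) auto

lemma paint_cong:
  "(\<And>K. K \<in> set Ks \<Longrightarrow> c \<in> X K \<longleftrightarrow> c' \<in> X K) \<Longrightarrow> paint X s e Ks c = paint X s e Ks c'"
  by (induction Ks) auto

lemma paint_pm:
  "(\<And>K. K \<in> set Ks \<Longrightarrow> s K = 1 \<or> s K = -1) \<Longrightarrow> e = 1 \<or> e = -1 \<Longrightarrow>
    paint X s e Ks c = 1 \<or> paint X s e Ks c = -1"
  by (induction Ks) auto

text \<open>
The earlier entries that contain \<open>c\<close> would have regions inside that of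
\<open>K\<close>, which the last hypothesis excludes; so \<open>K\<close> is the last set to
paint \<open>c\<close>.
\<close>

lemma paint_own:
  assumes "sorted_wrt (\<lambda>K K'. X K \<subseteq> X K' \<or> X K \<inter> X K' = {}) Ks" "K \<in> set Ks" "c \<in> X K"
    "\<And>K'. K' \<in> set Ks \<Longrightarrow> K' \<noteq> K \<Longrightarrow> c \<in> X K' \<Longrightarrow> \<not> X K' \<subseteq> X K"
  shows "paint X s e Ks c = s K"
  using assms by (induction Ks) auto

definition weight :: "cell set \<Rightarrow> (cell \<Rightarrow> int) \<Rightarrow> int" where
  "weight A f = (\<Sum>c\<in>A. col c * f c)"

lemma weight_const: "weight A (\<lambda>c. e) = e * excess A"
  by (simp add: weight_def excess_def sum_distrib_left mult.commute)

lemma weight_paint_Cons: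
  assumes "finite A" and "\<And>c. c \<in> X K \<Longrightarrow> paint X s e Ks c = d"
  shows "weight A (paint X s e (K # Ks)) = weight A (paint X s e Ks) + (s K - d) * excess (X K \<inter> A)"
proof -
  have "weight A (paint X s e (K # Ks)) - weight A (paint X s e Ks)
      = (\<Sum>c\<in>A. if c \<in> X K then (s K - d) * col c else 0)"
    unfolding weight_def sum_subtractf[symmetric]
    by (rule sum.cong) (auto simp: assms(2) algebra_simps)
  also have "\<dots> = (\<Sum>c\<in>X K \<inter> A. (s K - d) * col c)"
    using assms(1) by (simp add: sum.If_cases Int_commute)
  finally show ?thesis by (simp add: excess_def sum_distrib_left)
qed

section \<open>Changes along a line and sets without three consecutive numbers\<close>

lemma constant_without_change:
  fixes f :: "nat \<Rightarrow> bool"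
  assumes "a \<le> b" "\<And>j. a \<le> j \<Longrightarrow> j < b \<Longrightarrow> f j = f (Suc j)"
  shows "f b = f a"
  using assms by (induction b rule: dec_induct) simp_all

lemma change_exists:
  fixes f :: "nat \<Rightarrow> bool"
  assumes "f 1 \<noteq> f n" "n \<ge> 1"
  obtains j where "j \<in> {1..<n}" "f j \<noteq> f (Suc j)"
  using constant_without_change[of 1 n f] assms by fastforce

lemma sum_change_ge_1:
  fixes f :: "nat \<Rightarrow> bool"
  assumes "f 1 \<noteq> f n" "n \<ge> 1"
  shows "(1::int) \<le> (\<Sum>j\<in>{1..<n}. of_bool (f j \<noteq> f (Suc j)))"
proof -
  obtain j where j: "j \<in> {1..<n}" "f j \<noteq> f (Suc j)" using change_exists[OF assms] .
  have "of_bool (f j \<noteq> f (Suc j)) \<le> (\<Sum>j\<in>{1..<n}. of_bool (f j \<noteq> f (Suc j)) :: int)"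
    by (rule member_le_sum) (use j in auto)
  then show ?thesis using j by simp
qed

lemma single_change:
  fixes f :: "nat \<Rightarrow> bool"
  assumes "f 1 \<noteq> f n" "n \<ge> 1" "(\<Sum>j\<in>{1..<n}. of_bool (f j \<noteq> f (Suc j)) :: int) \<le> 1"
  shows "\<exists>q\<ge>1. q < n \<and> (\<forall>k\<in>{1..n}. f k = (if k \<le> q then f 1 else f n))"
proof -
  obtain q where q: "q \<in> {1..<n}" "f q \<noteq> f (Suc q)" using change_exists[OF assms(1,2)] .
  have uniq: "f j = f (Suc j)" if "1 \<le> j" "j < n" "j \<noteq> q" for j
  proof (rule ccontr)
    assume j: "f j \<noteq> f (Suc j)"
    have "(\<Sum>j\<in>{j, q}. of_bool (f j \<noteq> f (Suc j)) :: int) \<le> (\<Sum>j\<in>{1..<n}. of_bool (f j \<noteq> f (Suc j)))"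
      using that q by (intro sum_mono2) auto
    then show False using j q that assms(3) by simp
  qed
  have "f k = (if k \<le> q then f 1 else f n)" if k: "k \<in> {1..n}" for k
  proof (cases "k \<le> q")
    case True
    have "f k = f 1"
    proof (rule constant_without_change)
      fix j assume "1 \<le> j" "j < k"
      then show "f j = f (Suc j)" using True k q by (intro uniq) auto
    qed (use k in simp)
    then show ?thesis using True by simp
  next
    case False
    have "f n = f k"
    proof (rule constant_without_change)
      fix j assume "k \<le> j" "j < n"
      then show "f j = f (Suc j)" using False k by (intro uniq) auto
    qed (use k in simp)
    then show ?thesis using False by simp
  qed
  moreover have "q \<ge> 1" "q < n" using q by auto
  ultimately show ?thesis by blast
qed

lemma card_no_three_consecutive:
  fixes P :: "nat set"
  assumes "P \<subseteq> {1..L}" "\<And>k. k \<in> P \<Longrightarrow> Suc k \<in> P \<Longrightarrow> Suc (Suc k) \<notin> P"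
  shows "card P \<le> L - L div 3"
  using assms
proof (induction L arbitrary: P rule: less_induct)
  case (less L)
  show ?case
  proof (cases "L < 3")
    case True
    then have "card P \<le> card {1..L}" using less.prems by (intro card_mono) auto
    then show ?thesis using True by simp
  next
    case False
    define K where "K = L - 3"
    have L: "L = Suc (Suc (Suc K))" using False by (simp add: K_def)
    have "card (P \<inter> {1..K}) \<le> K - K div 3"
      using less.prems by (intro less.IH) (auto simp: L)
    moreover have "card (P \<inter> {Suc K, Suc (Suc K), L}) \<le> 2"
    proof -
      have "P \<inter> {Suc K, Suc (Suc K), L} \<noteq> {Suc K, Suc (Suc K), L}"
        using less.prems(2)[of "Suc K"] by (auto simp: L)
      then have "card (P \<inter> {Suc K, Suc (Suc K), L}) < card {Suc K, Suc (Suc K), L}"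
        by (intro psubset_card_mono) auto
      then show ?thesis by (simp add: L)
    qed
    moreover have "P = (P \<inter> {1..K}) \<union> (P \<inter> {Suc K, Suc (Suc K), L})"
      using less.prems(1) by (auto simp: L le_Suc_eq)
    then have "card P \<le> card (P \<inter> {1..K}) + card (P \<inter> {Suc K, Suc (Suc K), L})"
      by (metis card_Un_le)
    moreover have "L - L div 3 = K - K div 3 + 2" by (simp add: L)
    ultimately show ?thesis by linarith
  qed
qed

section \<open>Phases and nodes of a packing\<close>

text \<open>
A set \<open>T\<close> and a matching \<open>M\<close> in the grid that form a pair as in the
definition of \<open>\<Omega>\<close>: every cell of \<open>T\<close> has at most one neighbour
among the covered cells \<open>T \<union> \<Union>M\<close>. The other cells are called empty
below.
\<close>

locale packing =
  fixes m n :: nat and T :: "cell set" and M :: "cell set set"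
  assumes m1: "m \<ge> 1" and n1: "n \<ge> 1"
    and T_sub: "T \<subseteq> rect m n"
    and M_edge: "\<And>e. e \<in> M \<Longrightarrow> \<exists>u v. e = {u, v} \<and> u \<in> rect m n \<and> v \<in> rect m n \<and> adj u v"
    and M_disj: "\<And>e e'. e \<in> M \<Longrightarrow> e' \<in> M \<Longrightarrow> e \<noteq> e' \<Longrightarrow> e \<inter> e' = {}"
    and TM_disj: "T \<inter> \<Union>M = {}"
    and T_nbr: "\<And>t d d'. t \<in> T \<Longrightarrow> d \<in> T \<union> \<Union>M \<Longrightarrow> d' \<in> T \<union> \<Union>M \<Longrightarrow>
      adj t d \<Longrightarrow> adj t d' \<Longrightarrow> d = d'"
begin

text \<open>
In a chessboard pattern of \<open>T\<close> and empty cells the phase is constant: it tells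
which colour \<open>T\<close> occupies. A matching edge covers one black and one white cell, so
its cells get phase \<open>0\<close> and contribute nothing to the weighted colour sum of the
phases, whatever common sign they are given.
\<close>

definition phase :: "cell \<Rightarrow> int" where
  "phase c = (if c \<in> T then col c else if c \<in> \<Union>M then 0 else - col c)"

definition comps :: "cell set set" where
  "comps = {{d. (c, d) \<in> reach {x \<in> rect m n. phase x = phase c}} | c. c \<in> rect m n \<and> phase c \<noteq> 0}"

definition sgn_of :: "cell set \<Rightarrow> int" where
  "sgn_of K = phase (SOME c. c \<in> K)"

abbreviation "X \<equiv> inner m n"

lemma phase_cases: "phase c = 0 \<or> phase c = 1 \<or> phase c = -1"
  using col_cases[of c] by (auto simp: phase_def)

lemma comp_props:
  assumes K: "K \<in> comps"
  shows comp_sub: "K \<subseteq> rect m n" and comp_ne: "K \<noteq> {}" and comp_conn: "conn K"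
    and comp_phase: "\<And>c. c \<in> K \<Longrightarrow> phase c = sgn_of K"
    and sgn_cases: "sgn_of K = 1 \<or> sgn_of K = -1"
    and comp_closed: "\<And>c d. c \<in> K \<Longrightarrow> d \<in> rect m n \<Longrightarrow> adj c d \<Longrightarrow> phase d = phase c \<Longrightarrow> d \<in> K"
proof -
  obtain c where c: "c \<in> rect m n" "phase c \<noteq> 0"
    and Kc: "K = {d. (c, d) \<in> reach {x \<in> rect m n. phase x = phase c}}"
    using K unfolding comps_def by blast
  have mem: "d \<in> rect m n \<and> phase d = phase c" if "d \<in> K" for d
    using reach_in[of c d "{x \<in> rect m n. phase x = phase c}"] that c by (simp add: Kc)
  show "K \<subseteq> rect m n" using mem by blast
  have cK: "c \<in> K" by (simp add: Kc reach_refl)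
  then show "K \<noteq> {}" by blast
  show "conn K" unfolding Kc by (rule conn_component)
  have "(SOME c. c \<in> K) \<in> K" using cK by (rule someI)
  then have s: "sgn_of K = phase c" using mem by (simp add: sgn_of_def)
  then show "phase d = sgn_of K" if "d \<in> K" for d using mem that by simp
  show "sgn_of K = 1 \<or> sgn_of K = -1" using s c(2) phase_cases[of c] by auto
  show "d \<in> K" if "b \<in> K" "d \<in> rect m n" "adj b d" "phase d = phase b" for b d
  proof -
    have "(b, d) \<in> reach {x \<in> rect m n. phase x = phase c}"
      using that mem[OF that(1)] by (intro reach_step) auto
    then show ?thesis using that(1) reach_trans[of c b _ d] by (simp add: Kc)
  qed
qed

lemma comp_exists:
  assumes "c \<in> rect m n" "phase c \<noteq> 0"
  obtains K where "K \<in> comps" "c \<in> K"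
proof -
  have "{d. (c, d) \<in> reach {x \<in> rect m n. phase x = phase c}} \<in> comps"
    using assms unfolding comps_def by blast
  then show ?thesis using that reach_refl by blast
qed

lemma finite_comps: "finite comps"
proof (rule finite_subset)
  show "comps \<subseteq> Pow (rect m n)" using comp_sub by blast
  show "finite (Pow (rect m n))" by (simp add: finite_rect)
qed

lemma comps_disjoint:
  assumes "K \<in> comps" "K' \<in> comps" "K \<noteq> K'"
  shows "K \<inter> K' = {}"
proof (rule ccontr)
  assume "K \<inter> K' \<noteq> {}"
  then obtain c where c: "c \<in> K" "c \<in> K'" by blast
  have "K1 \<subseteq> K2" if K: "K1 \<in> comps" "K2 \<in> comps" "c \<in> K1" "c \<in> K2" for K1 K2
  proof
    fix d assume d: "d \<in> K1"
    have "(c, d) \<in> reach K1" using comp_conn[OF K(1)] K(3) d unfolding conn_def by blast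
    then have "(c \<in> K2) = (d \<in> K2)"
    proof (rule reach_label)
      fix x y assume xy: "x \<in> K1" "y \<in> K1" "adj x y"
      then have "phase x = phase y" "x \<in> rect m n" "y \<in> rect m n"
        using comp_phase[OF K(1)] comp_sub[OF K(1)] by auto
      then show "(x \<in> K2) = (y \<in> K2)"
        using comp_closed[OF K(2), of x y] comp_closed[OF K(2), of y x] xy(3) adj_sym[OF xy(3)] by auto
    qed
    then show "d \<in> K2" using K(4) by simp
  qed
  then show False using assms c by blast
qed

text \<open>
An empty neighbour of a cell of \<open>T\<close> has the opposite colour, hence the same phase.
\<close>

lemma far_nbr_covered:
  assumes "t \<in> T" "d \<in> rect m n" "adj t d" "phase d \<noteq> phase t"
  shows "d \<in> T \<union> \<Union>M"
proof (rule ccontr)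
  assume "d \<notin> T \<union> \<Union>M"
  then have "phase d = phase t" using assms(1) col_adj[OF assms(3)] by (simp add: phase_def)
  then show False using assms(4) by simp
qed

text \<open>
Nodes are the components of constant nonzero phase that miss the root; the region \<open>X r
K\<close> is \<open>K\<close> together with everything that \<open>K\<close> separates from the
root.
\<close>

definition node :: "cell \<Rightarrow> cell set \<Rightarrow> bool" where
  "node r K \<longleftrightarrow> K \<in> comps \<and> r \<in> rect m n - K"

lemma node_comp: "node r K \<Longrightarrow> K \<in> comps" and node_root: "node r K \<Longrightarrow> r \<in> rect m n - K"
  by (auto simp: node_def)

lemma node_sub: "node r K \<Longrightarrow> K \<subseteq> X r K"
  by (rule subset_inner[OF node_root comp_sub[OF node_comp]])

lemma node_boundary:
  assumes "node r K" "c \<in> X r K" "d \<in> rect m n" "d \<notin> X r K" "adj c d"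
  shows "c \<in> K" "phase d \<noteq> phase c"
proof -
  have d: "d \<in> outer m n r K" using assms by (simp add: inner_def)
  show c: "c \<in> K" by (rule inner_boundary[OF node_root[OF assms(1)] assms(2) d assms(5)])
  show "phase d \<noteq> phase c"
    using comp_closed[OF node_comp[OF assms(1)] c assms(3,5)] node_sub[OF assms(1)] assms(4) by blast
qed

lemma node_laminar:
  assumes "node r K" "node r K'" "K \<noteq> K'"
  shows "X r K' \<subset> X r K \<and> X r K' \<inter> K = {} \<or> X r K \<subset> X r K' \<and> X r K \<inter> K' = {} \<or> X r K \<inter> X r K' = {}"
proof -
  note c = node_comp[OF assms(1)] and c' = node_comp[OF assms(2)]
  note r = node_root[OF assms(1)] node_root[OF assms(2)]
  have d: "K \<inter> K' = {}" "K' \<inter> K = {}" using comps_disjoint[OF c c' assms(3)] by auto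
  have *: "X r K2 \<subset> X r K1 \<and> X r K2 \<inter> K1 = {}"
    if "node r K1" "node r K2" "K1 \<inter> K2 = {}" "K2 \<subseteq> X r K1" for K1 K2
  proof -
    note c1 = node_comp[OF that(1)] and c2 = node_comp[OF that(2)]
    note i = inner_mono[OF node_root[OF that(1)] node_root[OF that(2)]
        comp_conn[OF c1] comp_sub[OF c1] comp_ne[OF c1] comp_sub[OF c2] that(3,4)]
    have "X r K2 \<inter> K1 = {}" using i(2) by (auto simp: inner_def)
    then show ?thesis using i(1) node_sub[OF that(1)] comp_ne[OF c1] by blast
  qed
  show ?thesis
    using inner_laminar[OF r comp_conn[OF c] comp_sub[OF c] comp_ne[OF c] comp_conn[OF c'] comp_sub[OF c']
        comp_ne[OF c'] d(1)] *[OF assms(1,2) d(1)] *[OF assms(2,1) d(2)] by blast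
qed

lemma conn_node: "node r K \<Longrightarrow> conn (X r K)"
  by (rule conn_inner) (auto simp: node_def comp_conn comp_sub[THEN subsetD] comp_ne)

lemma conn_node_compl: "node r K \<Longrightarrow> conn (rect m n - X r K)"
  using rect_minus_inner[OF node_root] conn_outer by simp

text \<open>
This is where the packing condition enters. A cell of the region with two neighbours outside
lies in \<open>K\<close>, and both neighbours have another phase. For a cell of \<open>T\<close>
both neighbours would be covered, which is one too many; so the cell is empty.
\<close>

lemma node_convex:
  assumes K: "node r K" and c: "c \<in> X r K" and d: "d \<in> rect m n - X r K" "d' \<in> rect m n - X r K"
    and ne: "d \<noteq> d'" and adj: "adj c d" "adj c d'"
  shows "sgn_of K * col c = -1"
proof -
  have cK: "c \<in> K" using node_boundary[OF K c] d adj by blast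
  have far: "phase d \<noteq> phase c" "phase d' \<noteq> phase c" using node_boundary[OF K c] d adj by blast+
  have ph: "phase c = sgn_of K" "sgn_of K = 1 \<or> sgn_of K = -1"
    using comp_phase[OF node_comp[OF K] cK] sgn_cases[OF node_comp[OF K]] by auto
  have "c \<notin> T"
    using far_nbr_covered[of c d] far_nbr_covered[of c d'] far d adj T_nbr[of c d d'] ne by blast
  then have "sgn_of K = - col c" using ph by (auto simp: phase_def split: if_splits)
  then show ?thesis using col_cases[of c] by auto
qed

lemma node_excess:
  assumes K: "node r K"
  shows "2 * (sgn_of K * excess (X r K))
      + (\<Sum>j\<in>{1..<n}. bad_end (X r K) (sgn_of K) (1, j) (1, Suc j))
      + (\<Sum>i\<in>{1..<m}. bad_end (X r K) (sgn_of K) (i, 1) (Suc i, 1))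
    \<le> own (X r K) (sgn_of K) (1, 1) + own (X r K) (sgn_of K) (1, n)
      + own (X r K) (sgn_of K) (m, 1) + own (X r K) (sgn_of K) (m, n)"
  by (rule excess_bound[OF m1 n1 inner_subset conn_node_compl[OF K] sgn_cases[OF node_comp[OF K]]])
    (rule node_convex[OF K])

text \<open>
The quantity to bound is the number of cells of \<open>T\<close> minus the number of empty cells, because twice
\<open>card T + card M\<close> is this number plus the number of all cells.
\<close>

lemma M_sub: "\<Union>M \<subseteq> rect m n"
  using M_edge by blast

definition surplus :: int where
  "surplus = int (card T) - int (card (rect m n - T - \<Union>M))"

lemma card_Union_matching: "card (\<Union>M) = 2 * card M"
proof -
  have "card e = 2 \<and> finite e" if "e \<in> M" for e
    using M_edge[OF that] adj_irrefl by (metis card_2_iff finite.intros)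
  then show ?thesis
    using M_disj by (subst card_Union_disjoint) (auto simp: pairwise_def disjnt_def)
qed

lemma surplus_weight: "2 * (int (card T) + int (card M)) = int (m * n) + surplus"
proof -
  have fin: "finite T" "finite (\<Union>M)" using T_sub M_sub finite_rect finite_subset by blast+
  have "card (rect m n - T - \<Union>M) = card (rect m n) - card (T \<union> \<Union>M)"
    using T_sub M_sub by (subst card_Diff_subset[symmetric]) (auto simp: fin Diff_eq Int_assoc)
  moreover have "card (T \<union> \<Union>M) = card T + 2 * card M"
    using TM_disj fin card_Union_matching by (subst card_Un_disjoint) auto
  moreover have "card (T \<union> \<Union>M) \<le> card (rect m n)"
    using T_sub M_sub by (intro card_mono finite_rect) auto
  moreover have "card (rect m n) = m * n" by (simp add: rect_def)
  ultimately show ?thesis by (simp add: surplus_def)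
qed

text \<open>
Both cells of \<open>T\<close> and empty cells contribute the right sign to the weighted colour
sum of the phases, and each matching edge cancels as soon as its two cells get the same label.
\<close>

lemma surplus_eq_weight:
  assumes f: "\<And>c. c \<in> rect m n \<Longrightarrow> phase c \<noteq> 0 \<Longrightarrow> f c = phase c"
    and fM: "\<And>u v. {u, v} \<in> M \<Longrightarrow> f u = f v"
  shows "surplus = weight (rect m n) f"
proof -
  let ?R = "rect m n - T - \<Union>M"
  have fin: "finite T" "finite (\<Union>M)" using T_sub M_sub finite_rect finite_subset by blast+
  have eq: "rect m n = (T \<union> \<Union>M) \<union> ?R" using T_sub M_sub by blast
  have "weight (rect m n) f = weight (T \<union> \<Union>M) f + weight ?R f"
    unfolding weight_def by (subst eq, rule sum.union_disjoint) (auto simp: fin finite_rect)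
  also have "weight (T \<union> \<Union>M) f = weight T f + weight (\<Union>M) f"
    unfolding weight_def by (rule sum.union_disjoint) (use fin TM_disj in auto)
  also have "weight T f = (\<Sum>c\<in>T. 1)" unfolding weight_def
  proof (rule sum.cong[OF refl])
    fix c assume c: "c \<in> T"
    then have "f c = col c" using f[of c] T_sub col_cases[of c] by (auto simp: phase_def)
    then show "col c * f c = 1" using col_cases[of c] by auto
  qed
  also have "weight ?R f = (\<Sum>c\<in>?R. -1)" unfolding weight_def
  proof (rule sum.cong[OF refl])
    fix c assume c: "c \<in> ?R"
    then have "f c = - col c" using f[of c] col_cases[of c] by (auto simp: phase_def)
    then show "col c * f c = -1" using col_cases[of c] by auto
  qed
  also have "weight (\<Union>M) f = (\<Sum>e\<in>M. \<Sum>c\<in>e. col c * f c)" unfolding weight_def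
  proof (rule sum.Union_disjoint[THEN trans])
    show "\<forall>A\<in>M. finite A" using M_sub finite_rect by (meson Union_upper finite_subset)
    show "\<forall>A\<in>M. \<forall>B\<in>M. A \<noteq> B \<longrightarrow> A \<inter> B = {}" using M_disj by blast
  qed simp
  also have "\<dots> = 0"
  proof (rule sum.neutral, rule ballI)
    fix e assume e: "e \<in> M"
    obtain u v where uv: "e = {u, v}" "adj u v" using M_edge[OF e] by blast
    then have "u \<noteq> v" "f u = f v" "col v = - col u" using adj_irrefl fM e col_adj by blast+
    then show "(\<Sum>c\<in>e. col c * f c) = 0" by (simp add: uv(1))
  qed
  finally show ?thesis by (simp add: surplus_def)
qed

end

section \<open>Reduction of the surplus to a line of cells\<close>

context packing
begin

abbreviation (input) nested :: "cell \<Rightarrow> cell set \<Rightarrow> cell set \<Rightarrow> bool" where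
  "nested r K K' \<equiv> X r K \<subseteq> X r K' \<or> X r K \<inter> X r K' = {}"

lemma finite_X: "finite (X r K)"
  by (rule finite_subset[OF inner_subset finite_rect])

lemma sorted_nodes:
  assumes "S \<subseteq> Collect (node r)"
  obtains Ks where "set Ks = S" "sorted_wrt (nested r) Ks"
proof -
  have "S \<subseteq> comps" using assms node_comp by blast
  then have "finite S" using finite_comps finite_subset by blast
  then obtain xs where xs: "set xs = S" using finite_list by blast
  let ?f = "\<lambda>K. card (X r K)"
  have "sorted_wrt (\<lambda>a b. ?f a \<le> ?f b) (sort_key ?f xs)"
    using sorted_sort_key[of ?f xs] by (simp add: sorted_map)
  then have "sorted_wrt (nested r) (sort_key ?f xs)"
  proof (rule sorted_wrt_mono_rel[rotated])
    fix K K' assume K: "K \<in> set (sort_key ?f xs)" "K' \<in> set (sort_key ?f xs)" and le: "?f K \<le> ?f K'"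
    then have nd: "node r K" "node r K'" using xs assms by auto
    show "nested r K K'"
    proof (cases "K = K'")
      case False
      have "\<not> X r K' \<subset> X r K" using le psubset_card_mono[OF finite_X] by (meson not_le)
      then show ?thesis using node_laminar[OF nd False] by blast
    qed simp
  qed
  then show ?thesis using that[of "sort_key ?f xs"] xs by simp
qed

lemma root_comp_outside:
  assumes "K \<in> comps" "r \<in> K" "node r K'"
  shows "K \<inter> X r K' = {}"
proof -
  have "K \<noteq> K'" using assms node_root by blast
  then have "K \<inter> K' = {}" using comps_disjoint assms(1) node_comp[OF assms(3)] by blast
  then have "K \<subseteq> outer m n r K'"
    using conn_subset_outer[OF comp_conn[OF assms(1)] _ assms(2) root_in_outer] comp_sub[OF assms(1)] by blast
  then show ?thesis by (auto simp: inner_def)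
qed

text \<open>
Painting with the phases of the nodes restores the phase of every cell of a painted component,
and of the component that contains the root.
\<close>

lemma paint_genuine:
  assumes Ks: "set Ks \<subseteq> Collect (node r)" "sorted_wrt (nested r) Ks"
    and root: "phase r \<noteq> 0 \<Longrightarrow> e = phase r"
    and K: "K \<in> comps" "K \<in> set Ks \<or> r \<in> K" "c \<in> K"
  shows "paint (X r) sgn_of e Ks c = phase c"
proof (cases "r \<in> K")
  case True
  have "phase r = phase c" "phase c \<noteq> 0"
    using comp_phase[OF K(1)] True K(3) sgn_cases[OF K(1)] by auto
  moreover have "paint (X r) sgn_of e Ks c = e"
    by (rule paint_outside) (use root_comp_outside[OF K(1) True] Ks(1) K(3) in blast)
  ultimately show ?thesis using root by simp
next
  case False
  then have K': "K \<in> set Ks" using K by blast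
  then have nd: "node r K" using Ks by blast
  have "paint (X r) sgn_of e Ks c = sgn_of K"
  proof (rule paint_own[OF Ks(2) K'])
    show "c \<in> X r K" using node_sub[OF nd] K(3) by blast
    fix K' assume "K' \<in> set Ks" "K' \<noteq> K" "c \<in> X r K'"
    then show "\<not> X r K' \<subseteq> X r K"
      using node_laminar[OF nd, of K'] Ks(1) K(3) node_sub[OF nd] by blast
  qed
  then show ?thesis using comp_phase[OF K(1) K(3)] by simp
qed

text \<open>
Cells of a matching edge belong to no component, hence no region separates them; they are
painted alike although their phase is \<open>0\<close>, and \<open>surplus_eq_weight\<close>
applies.
\<close>

lemma surplus_paint:
  assumes Ks: "set Ks = Collect (node r)" "sorted_wrt (nested r) Ks"
    and r: "r \<in> rect m n" and root: "phase r \<noteq> 0 \<Longrightarrow> e = phase r"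
  shows "surplus = weight (rect m n) (paint (X r) sgn_of e Ks)"
proof (rule surplus_eq_weight)
  fix c assume c: "c \<in> rect m n" "phase c \<noteq> 0"
  obtain K where K: "K \<in> comps" "c \<in> K" using comp_exists[OF c] .
  then have "K \<in> set Ks \<or> r \<in> K" using Ks r by (auto simp: node_def)
  then show "paint (X r) sgn_of e Ks c = phase c"
    using paint_genuine[of Ks r e K c] Ks root K by simp
next
  fix u v assume uv: "{u, v} \<in> M"
  then obtain a b where ab: "{u, v} = {a, b}" "a \<in> rect m n" "b \<in> rect m n" "adj a b"
    using M_edge by blast
  then have rect: "u \<in> rect m n" "v \<in> rect m n" and adj: "adj u v" "adj v u"
    by (auto simp: doubleton_eq_iff intro: adj_sym)
  have "u \<notin> T" "v \<notin> T" using uv TM_disj by blast+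
  then have "phase u = 0" "phase v = 0" using uv by (auto simp: phase_def)
  then have no: "u \<notin> K" "v \<notin> K" if "K \<in> comps" for K
    using comp_phase[OF that] sgn_cases[OF that] by fastforce+
  show "paint (X r) sgn_of e Ks u = paint (X r) sgn_of e Ks v"
  proof (rule paint_cong)
    fix K assume "K \<in> set Ks"
    then have K: "node r K" using Ks by blast
    show "(u \<in> X r K) = (v \<in> X r K)"
      using node_boundary(1)[OF K _ rect(2) _ adj(1)] node_boundary(1)[OF K _ rect(1) _ adj(2)]
        no[OF node_comp[OF K]] by blast
  qed
qed

text \<open>
The sets painted before \<open>K\<close> have regions that contain the region of
\<open>K\<close> or avoid it. So the region of \<open>K\<close> was painted uniformly, with some
sign \<open>d\<close>, and repainting it changes the weight by a multiple of its excess.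
\<close>

lemma weight_step:
  assumes K: "node r K" and Ks: "set Ks \<subseteq> Collect (node r)"
    and nest: "\<And>K'. K' \<in> set Ks \<Longrightarrow> nested r K K'"
    and e: "e = 1 \<or> e = -1"
  shows "\<exists>d::int. (d = 1 \<or> d = -1) \<and>
    (\<forall>A. finite A \<longrightarrow> weight A (paint (X r) sgn_of e (K # Ks))
      = weight A (paint (X r) sgn_of e Ks) + (sgn_of K - d) * excess (X r K \<inter> A))"
proof -
  obtain c where c: "c \<in> X r K" using node_sub[OF K] comp_ne[OF node_comp[OF K]] by blast
  have const: "paint (X r) sgn_of e Ks x = paint (X r) sgn_of e Ks c" if "x \<in> X r K" for x
    by (rule paint_cong) (use nest that c in blast)
  moreover have "paint (X r) sgn_of e Ks c = 1 \<or> paint (X r) sgn_of e Ks c = -1"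
  proof (rule paint_pm[OF _ e])
    fix K' assume "K' \<in> set Ks"
    then show "sgn_of K' = 1 \<or> sgn_of K' = -1" using Ks by (intro sgn_cases node_comp[of r]) blast
  qed
  ultimately show ?thesis
    by (intro exI[of _ "paint (X r) sgn_of e Ks c"] conjI allI impI weight_paint_Cons)
qed

text \<open>
Repainting either changes nothing or changes \<open>d = - sgn_of K\<close> into \<open>sgn_of
K\<close>; a region of nonpositive signed excess does not gain by it.
\<close>

lemma drop_pockets:
  assumes "set (P @ C) \<subseteq> Collect (node r)" "sorted_wrt (nested r) (P @ C)" "e = 1 \<or> e = -1"
    and "\<And>K. K \<in> set P \<Longrightarrow> sgn_of K * excess (X r K) \<le> 0"
  shows "weight (rect m n) (paint (X r) sgn_of e (P @ C)) \<le> weight (rect m n) (paint (X r) sgn_of e C)"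
  using assms
proof (induction P)
  case (Cons K P)
  have K: "node r K" and sub: "set (P @ C) \<subseteq> Collect (node r)" using Cons.prems(1) by auto
  have nest: "nested r K K'" if "K' \<in> set (P @ C)" for K' using Cons.prems(2) that by auto
  obtain d :: int where d: "d = 1 \<or> d = -1"
    "\<And>A. finite A \<Longrightarrow> weight A (paint (X r) sgn_of e (K # P @ C))
      = weight A (paint (X r) sgn_of e (P @ C)) + (sgn_of K - d) * excess (X r K \<inter> A)"
    using weight_step[OF K sub nest Cons.prems(3)] by blast
  have XK: "X r K \<inter> rect m n = X r K" using inner_subset[of m n r K] by blast
  have "(sgn_of K - d) * excess (X r K) \<le> 0"
    using d(1) sgn_cases[OF node_comp[OF K]] Cons.prems(4)[of K] by auto
  moreover have "weight (rect m n) (paint (X r) sgn_of e (P @ C)) \<le> weight (rect m n) (paint (X r) sgn_of e C)"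
    by (rule Cons.IH[OF sub _ Cons.prems(3)]) (use Cons.prems(2,4) in auto)
  ultimately show ?case
    using d(2)[OF finite_rect[of m n], unfolded XK] unfolding append_Cons by linarith
qed simp

text \<open>
Here the repaintings gain weight on the whole rectangle, but no more than on the set
\<open>A\<close>. In the application \<open>A\<close> is a border line of the rectangle, or
empty.
\<close>

lemma chains_to_line:
  assumes "set C \<subseteq> Collect (node r)" "sorted_wrt (nested r) C" "e = 1 \<or> e = -1"
    and A: "finite A" "excess (rect m n) = excess A"
    and "\<And>K. K \<in> set C \<Longrightarrow> sgn_of K * excess (X r K) \<le> sgn_of K * excess (X r K \<inter> A)"
  shows "weight (rect m n) (paint (X r) sgn_of e C) \<le> weight A (paint (X r) sgn_of e C)"
  using assms(1-3,6)
proof (induction C)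
  case Nil
  then show ?case
    using A weight_const[of "rect m n" e] weight_const[of A e] by (simp add: weight_def)
next
  case (Cons K C)
  have K: "node r K" and sub: "set C \<subseteq> Collect (node r)" using Cons.prems(1) by auto
  have nest: "nested r K K'" if "K' \<in> set C" for K' using Cons.prems(2) that by auto
  obtain d :: int where d: "d = 1 \<or> d = -1"
    "\<And>A. finite A \<Longrightarrow> weight A (paint (X r) sgn_of e (K # C))
      = weight A (paint (X r) sgn_of e C) + (sgn_of K - d) * excess (X r K \<inter> A)"
    using weight_step[OF K sub nest Cons.prems(3)] by blast
  have XK: "X r K \<inter> rect m n = X r K" using inner_subset[of m n r K] by blast
  have "(sgn_of K - d) * excess (X r K) \<le> (sgn_of K - d) * excess (X r K \<inter> A)"
    using d(1) sgn_cases[OF node_comp[OF K]] Cons.prems(4)[of K] by auto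
  moreover have "weight (rect m n) (paint (X r) sgn_of e C) \<le> weight A (paint (X r) sgn_of e C)"
    by (rule Cons.IH[OF sub _ Cons.prems(3)]) (use Cons.prems(2,4) in auto)
  ultimately show ?case
    using d(2)[OF finite_rect[of m n], unfolded XK] d(2)[OF A(1)] by linarith
qed

text \<open>
The nodes with \<open>ch\<close> will be those whose regions join two opposite sides of the
rectangle. By the hypothesis \<open>up\<close> their regions lie in no region of the remaining
nodes, so the remaining nodes can be painted last and dropped first.
\<close>

lemma surplus_le_line:
  assumes r: "r \<in> rect m n" and root: "phase r \<noteq> 0 \<Longrightarrow> e = phase r" and e: "e = 1 \<or> e = -1"
    and up: "\<And>K K'. node r K \<Longrightarrow> node r K' \<Longrightarrow> ch K \<Longrightarrow> X r K \<subset> X r K' \<Longrightarrow> ch K'"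
    and pocket: "\<And>K. node r K \<Longrightarrow> \<not> ch K \<Longrightarrow> sgn_of K * excess (X r K) \<le> 0"
    and A: "finite A" "excess (rect m n) = excess A"
    and chain: "\<And>K. node r K \<Longrightarrow> ch K \<Longrightarrow>
      sgn_of K * excess (X r K) \<le> sgn_of K * excess (X r K \<inter> A)"
  shows "\<exists>C. set C = {K. node r K \<and> ch K} \<and> sorted_wrt (nested r) C \<and>
    surplus \<le> weight A (paint (X r) sgn_of e C)"
proof -
  obtain P where P: "set P = {K. node r K \<and> \<not> ch K}" "sorted_wrt (nested r) P"
    using sorted_nodes[of "{K. node r K \<and> \<not> ch K}" r] by auto
  obtain C where C: "set C = {K. node r K \<and> ch K}" "sorted_wrt (nested r) C"
    using sorted_nodes[of "{K. node r K \<and> ch K}" r] by auto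
  have "nested r K K'" if "K \<in> set P" "K' \<in> set C" for K K'
    using node_laminar[of r K K'] up[of K' K] that P C by blast
  then have PC: "sorted_wrt (nested r) (P @ C)" using P C by (simp add: sorted_wrt_append)
  have set: "set (P @ C) = Collect (node r)" using P C by auto
  have "surplus = weight (rect m n) (paint (X r) sgn_of e (P @ C))"
    by (rule surplus_paint[OF set PC r root])
  also have "\<dots> \<le> weight (rect m n) (paint (X r) sgn_of e C)"
    by (rule drop_pockets[OF _ PC e]) (use set P pocket in auto)
  also have "\<dots> \<le> weight A (paint (X r) sgn_of e C)"
    by (rule chains_to_line[OF _ C(2) e A]) (use C chain in auto)
  finally show ?thesis using C by blast
qed

text \<open>
The painted line cannot have three consecutive cells whose label equals their colour. Labels
would change on both sides of the middle cell \<open>b\<close>. If \<open>b\<close> carries its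
own phase, it lies in \<open>T\<close> and both its neighbours on the line are covered, against
the packing condition. Otherwise both changes come from the neighbours: one region ends just
before \<open>b\<close> and another starts just after it, so \<open>b\<close> is the only cell
of the line outside all regions. By the hypothesis \<open>free\<close> it then belongs to the
component of the root, and carries its own phase after all.
\<close>

lemma line_bound:
  fixes g :: "nat \<Rightarrow> cell"
  assumes C: "set C = {K. node r K \<and> ch K}" "sorted_wrt (nested r) C"
    and root: "phase r \<noteq> 0 \<Longrightarrow> e = phase r" and e: "e = 1 \<or> e = -1"
    and g: "\<And>k. k \<in> {1..L} \<Longrightarrow> g k \<in> rect m n" "inj_on g {1..L}"
      "\<And>k. 1 \<le> k \<Longrightarrow> k < L \<Longrightarrow> adj (g k) (g (Suc k))"
    and seg: "\<And>K. node r K \<Longrightarrow> ch K \<Longrightarrow> \<exists>q\<ge>1. q < L \<and>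
      ((\<forall>k\<in>{1..L}. g k \<in> X r K \<longleftrightarrow> k \<le> q) \<or> (\<forall>k\<in>{1..L}. g k \<in> X r K \<longleftrightarrow> q < k))"
    and free: "\<exists>k0\<in>{1..L}. (\<forall>K. node r K \<longrightarrow> g k0 \<notin> X r K) \<and>
      (k0 = 1 \<or> k0 = L \<or> (\<exists>K\<in>comps. r \<in> K \<and> g k0 \<in> K))"
  shows "weight (g ` {1..L}) (paint (X r) sgn_of e C) \<le> int L - 2 * int (L div 3)"
proof -
  define l where "l = paint (X r) sgn_of e C"
  have Csub: "set C \<subseteq> Collect (node r)" using C by auto
  \<comment> \<open>A cell is genuine if it lies in a painted component or in the component of the root;
    its label is then its phase.\<close>
  define gen where "gen c \<longleftrightarrow> (\<exists>K\<in>comps. c \<in> K \<and> (K \<in> set C \<or> r \<in> K))" for c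
  have l_pm: "l c = 1 \<or> l c = -1" for c
    unfolding l_def
  proof (rule paint_pm[OF _ e])
    fix K assume "K \<in> set C"
    then show "sgn_of K = 1 \<or> sgn_of K = -1" using Csub by (intro sgn_cases node_comp[of r]) blast
  qed
  have gen_l: "l x = phase x" if "K \<in> comps" "K \<in> set C \<or> r \<in> K" "x \<in> K" for K x
    unfolding l_def by (rule paint_genuine[OF Csub C(2) root that])
  have genT: "c \<in> T \<and> d \<in> T \<union> \<Union>M"
    if c: "gen c" "c \<in> rect m n" "col c * l c = 1" and d: "d \<in> rect m n" "adj c d" "l d \<noteq> l c" for c d
  proof -
    obtain K where K: "K \<in> comps" "c \<in> K" "K \<in> set C \<or> r \<in> K" using c(1) gen_def by blast
    have lc: "l c = phase c" by (rule gen_l[OF K(1,3,2)])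
    have cT: "c \<in> T" using c(3) lc col_cases[of c] by (auto simp: phase_def split: if_splits)
    have "phase d \<noteq> phase c"
    proof
      assume eq: "phase d = phase c"
      then have "d \<in> K" using comp_closed[OF K(1,2) d(1,2)] by blast
      then have "l d = phase d" by (rule gen_l[OF K(1,3)])
      then show False using d(3) lc eq by simp
    qed
    then show ?thesis using far_nbr_covered[OF cT d(1,2)] cT by blast
  qed
  define P where "P = {k \<in> {1..L}. col (g k) * l (g k) = 1}"
  have no3: "Suc (Suc k) \<notin> P" if k: "k \<in> P" "Suc k \<in> P" for k
  proof
    assume k2: "Suc (Suc k) \<in> P"
    have rng: "1 \<le> k" "Suc (Suc k) \<le> L" using k k2 by (auto simp: P_def)
    let ?a = "g k" and ?b = "g (Suc k)" and ?c = "g (Suc (Suc k))"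
    have rect: "?a \<in> rect m n" "?b \<in> rect m n" "?c \<in> rect m n" using rng by (auto intro!: g(1))
    have adj: "adj ?a ?b" "adj ?b ?c" "adj ?b ?a" using rng by (auto intro!: g(3) adj_sym[OF g(3)])
    have ne: "?a \<noteq> ?c" using inj_onD[OF g(2), of k "Suc (Suc k)"] rng by auto
    have val: "col ?a * l ?a = 1" "col ?b * l ?b = 1" "col ?c * l ?c = 1"
      using k k2 by (auto simp: P_def)
    have dif: "l ?a \<noteq> l ?b" "l ?c \<noteq> l ?b"
      using val col_adj[OF adj(1)] col_adj[OF adj(2)] l_pm[of ?b] col_cases[of ?b] by auto
    have ngen: "\<not> gen ?b"
    proof
      assume b: "gen ?b"
      show False
        using genT[OF b rect(2) val(2) rect(1) adj(3) dif(1)] genT[OF b rect(2) val(2) rect(3) adj(2) dif(2)]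
          T_nbr adj ne by blast
    qed
    have wall: "\<exists>K\<in>set C. d \<in> X r K \<and> ?b \<notin> X r K"
      if d: "d \<in> rect m n" "adj ?b d" "l d \<noteq> l ?b" for d
    proof -
      obtain K where K: "K \<in> set C" "(d \<in> X r K) \<noteq> (?b \<in> X r K)"
        using d(3) paint_cong[of C d "X r" ?b sgn_of e] unfolding l_def by blast
      have nd: "node r K" using K C by blast
      have "?b \<notin> X r K"
        using node_boundary(1)[OF nd _ d(1) _ d(2)] K ngen node_comp[OF nd] unfolding gen_def by blast
      then show ?thesis using K by blast
    qed
    obtain K1 where K1: "K1 \<in> set C" "?a \<in> X r K1" "?b \<notin> X r K1"
      using wall[OF rect(1) adj(3) dif(1)] by blast
    obtain K2 where K2: "K2 \<in> set C" "?c \<in> X r K2" "?b \<notin> X r K2"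
      using wall[OF rect(3) adj(2) dif(2)] by blast
    have nd: "node r K1" "ch K1" "node r K2" "ch K2" using K1 K2 C by auto
    have in1: "g j \<in> X r K1" if "j \<in> {1..L}" "j \<le> k" for j
    proof -
      obtain q where q: "(\<forall>k\<in>{1..L}. g k \<in> X r K1 \<longleftrightarrow> k \<le> q) \<or> (\<forall>k\<in>{1..L}. g k \<in> X r K1 \<longleftrightarrow> q < k)"
        using seg[OF nd(1,2)] by blast
      have "k \<in> {1..L}" "Suc k \<in> {1..L}" using rng by auto
      then show ?thesis using q K1 that by (metis le_trans less_Suc_eq)
    qed
    have in2: "g j \<in> X r K2" if "j \<in> {1..L}" "Suc (Suc k) \<le> j" for j
    proof -
      obtain q where q: "(\<forall>k\<in>{1..L}. g k \<in> X r K2 \<longleftrightarrow> k \<le> q) \<or> (\<forall>k\<in>{1..L}. g k \<in> X r K2 \<longleftrightarrow> q < k)"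
        using seg[OF nd(3,4)] by blast
      have "Suc (Suc k) \<in> {1..L}" "Suc k \<in> {1..L}" using rng by auto
      then show ?thesis using q K2 that by (metis Suc_leD less_le_trans)
    qed
    obtain k0 where k0: "k0 \<in> {1..L}" "\<And>K. node r K \<Longrightarrow> g k0 \<notin> X r K"
      "k0 = 1 \<or> k0 = L \<or> (\<exists>K\<in>comps. r \<in> K \<and> g k0 \<in> K)"
      using free by blast
    have "k0 = Suc k"
      using in1[of k0] in2[of k0] k0(1) k0(2)[OF nd(1)] k0(2)[OF nd(3)] by (meson le_antisym not_less_eq_eq)
    then have "\<exists>K\<in>comps. r \<in> K \<and> ?b \<in> K" using k0(3) rng by auto
    then show False using ngen unfolding gen_def by blast
  qed
  have cardP: "card P \<le> L - L div 3"
    by (rule card_no_three_consecutive) (use no3 in \<open>auto simp: P_def\<close>)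
  have "weight (g ` {1..L}) l = (\<Sum>k\<in>{1..L}. col (g k) * l (g k))"
    unfolding weight_def sum.reindex[OF g(2)] by simp
  also have "\<dots> = (\<Sum>k\<in>{1..L}. 2 * of_bool (k \<in> P) - 1)"
  proof (rule sum.cong[OF refl])
    fix k assume "k \<in> {1..L}"
    then show "col (g k) * l (g k) = 2 * of_bool (k \<in> P) - 1"
      using col_cases[of "g k"] l_pm[of "g k"] by (auto simp: P_def)
  qed
  also have "\<dots> = 2 * int (card P) - int L"
  proof -
    have "{1..L} \<inter> P = P" by (auto simp: P_def)
    then show ?thesis by (simp add: sum_subtractf flip: sum_distrib_left)
  qed
  also have "\<dots> \<le> int L - 2 * int (L div 3)"
  proof -
    have "int (card P) \<le> int L - int (L div 3)" using cardP div_le_dividend[of L 3] by linarith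
    then show ?thesis by linarith
  qed
  finally show ?thesis by (simp add: l_def)
qed

end

section \<open>Corners of the rectangle and the choice of the root\<close>

lemma alternating_sum:
  assumes "a \<le> b" "\<And>k. a \<le> k \<Longrightarrow> k < b \<Longrightarrow> adj (g k) (g (Suc k))"
  shows "2 * (\<Sum>k\<in>{a..b}. col (g k)) = col (g a) + col (g b)"
  using assms
proof (induction b rule: dec_induct)
  case (step b)
  have "col (g (Suc b)) = - col (g b)" using col_adj step.prems[of b] step.hyps by simp
  moreover have "2 * (\<Sum>k\<in>{a..b}. col (g k)) = col (g a) + col (g b)"
    by (rule step.IH) (use step.prems in simp)
  moreover have "{a..Suc b} = insert (Suc b) {a..b}" using step.hyps by auto
  ultimately show ?case by simp
qed simp

lemma excess_rect: "excess (rect m n) = int (m mod 2) * int (n mod 2)"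
proof -
  define s :: "nat \<Rightarrow> int" where "s k = (if odd k then 1 else -1)" for k
  have s: "(\<Sum>i\<in>{1..k}. s i) = int (k mod 2)" for k
    by (induction k) (auto simp: s_def, presburger+)
  have "excess (rect m n) = (\<Sum>i\<in>{1..m}. \<Sum>j\<in>{1..n}. s i * s j)"
    unfolding excess_def rect_def sum.cartesian_product by (rule sum.cong) (auto simp: col_def s_def)
  also have "\<dots> = (\<Sum>i\<in>{1..m}. s i) * (\<Sum>j\<in>{1..n}. s j)"
    by (simp add: sum_product)
  finally show ?thesis by (simp only: s)
qed

lemma excess_row: "excess ((\<lambda>j. (1, j)) ` {1..n}) = int (n mod 2)"
proof -
  have "(\<lambda>j. (1, j)) ` {1..n} = rect 1 n" by (auto simp: rect_def)
  then show ?thesis by (simp add: excess_rect)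
qed

lemma excess_column: "excess ((\<lambda>i. (i, 1)) ` {1..m}) = int (m mod 2)"
proof -
  have "(\<lambda>i. (i, 1)) ` {1..m} = rect m 1" by (auto simp: rect_def)
  then show ?thesis by (simp add: excess_rect)
qed

lemma single_change_segment:
  fixes f :: "nat \<Rightarrow> bool"
  assumes "f 1 \<noteq> f n" "n \<ge> 1" "(\<Sum>j\<in>{1..<n}. of_bool (f j \<noteq> f (Suc j)) :: int) \<le> 1"
  shows "\<exists>q\<ge>1. q < n \<and> ((\<forall>k\<in>{1..n}. f k \<longleftrightarrow> k \<le> q) \<or> (\<forall>k\<in>{1..n}. f k \<longleftrightarrow> q < k))"
proof -
  obtain q where q: "q \<ge> 1" "q < n" "\<forall>k\<in>{1..n}. f k = (if k \<le> q then f 1 else f n)"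
    using single_change[OF assms] by (elim exE conjE)
  show ?thesis
  proof (intro exI[of _ q] conjI q(1,2))
    show "(\<forall>k\<in>{1..n}. f k \<longleftrightarrow> k \<le> q) \<or> (\<forall>k\<in>{1..n}. f k \<longleftrightarrow> q < k)"
      using q(3) assms(1) by (cases "f 1") (metis not_le)+
  qed
qed

text \<open>
Here \<open>a\<close>, \<open>b\<close>, \<open>c\<close>, \<open>d\<close> say which corners a
region contains, \<open>a\<close> and \<open>d\<close> being opposite, as are \<open>b\<close>
and \<open>c\<close>; the corners \<open>a\<close>, \<open>c\<close> have colour
\<open>1\<close> and the corners \<open>b\<close>, \<open>d\<close> have colour
\<open>t\<close>.
\<close>

lemma at_most_one_own_corner:
  fixes s t :: int
  assumes "s = 1 \<or> s = -1" "t = 1 \<or> t = -1"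
    and "\<not> (a \<and> d)" "\<not> (b \<and> c)"
    and "\<not> ((a \<longleftrightarrow> c) \<and> (b \<longleftrightarrow> d) \<and> (a \<longleftrightarrow> \<not> b))"
    and "t = 1 \<Longrightarrow> \<not> ((a \<longleftrightarrow> b) \<and> (c \<longleftrightarrow> d) \<and> (a \<longleftrightarrow> \<not> c))"
  shows "of_bool (a \<and> s = 1) + of_bool (b \<and> s * t = 1) + of_bool (c \<and> s = 1) + of_bool (d \<and> s * t = 1) \<le> (1::int)"
  using assms by (cases a; cases b; cases c; cases d) auto

text \<open>
Corners are counted as positions: in a rectangle with a single row or column, coinciding corners
count twice.
\<close>

definition few :: "nat \<Rightarrow> nat \<Rightarrow> cell set \<Rightarrow> bool" where
  "few m n Y \<longleftrightarrow>
     \<not> ((1, 1) \<in> Y \<and> (1, n) \<in> Y \<and> (m, 1) \<in> Y) \<and> \<not> ((1, 1) \<in> Y \<and> (1, n) \<in> Y \<and> (m, n) \<in> Y) \<and>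
     \<not> ((1, 1) \<in> Y \<and> (m, 1) \<in> Y \<and> (m, n) \<in> Y) \<and> \<not> ((1, n) \<in> Y \<and> (m, 1) \<in> Y \<and> (m, n) \<in> Y)"

context packing
begin

lemma corners: "(1, 1) \<in> rect m n" "(1, n) \<in> rect m n" "(m, 1) \<in> rect m n" "(m, n) \<in> rect m n"
  using m1 n1 by (auto simp: mem_rect)

lemma border_changes:
  assumes "node r K"
  shows "(\<Sum>j\<in>{1..<n}. mixed (X r K) (1, j) (1, Suc j)) + (\<Sum>j\<in>{1..<n}. mixed (X r K) (m, j) (m, Suc j))
    + (\<Sum>i\<in>{1..<m}. mixed (X r K) (i, 1) (Suc i, 1)) + (\<Sum>i\<in>{1..<m}. mixed (X r K) (i, n) (Suc i, n)) \<le> 2"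
  by (rule border_changes_le_2[OF m1 n1 inner_subset conn_node[OF assms] conn_node_compl[OF assms]])

lemma mixed_nonneg: "0 \<le> mixed Y c d"
  by (simp add: mixed_def)

lemma mixed_ge_1:
  shows "((1, 1) \<in> Y) \<noteq> ((1, n) \<in> Y) \<Longrightarrow> 1 \<le> (\<Sum>j\<in>{1..<n}. mixed Y (1, j) (1, Suc j))"
    and "((m, 1) \<in> Y) \<noteq> ((m, n) \<in> Y) \<Longrightarrow> 1 \<le> (\<Sum>j\<in>{1..<n}. mixed Y (m, j) (m, Suc j))"
    and "((1, 1) \<in> Y) \<noteq> ((m, 1) \<in> Y) \<Longrightarrow> 1 \<le> (\<Sum>i\<in>{1..<m}. mixed Y (i, 1) (Suc i, 1))"
    and "((1, n) \<in> Y) \<noteq> ((m, n) \<in> Y) \<Longrightarrow> 1 \<le> (\<Sum>i\<in>{1..<m}. mixed Y (i, n) (Suc i, n))"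
  unfolding mixed_def
  using sum_change_ge_1[of "\<lambda>j. (1, j) \<in> Y" n] sum_change_ge_1[of "\<lambda>j. (m, j) \<in> Y" n]
    sum_change_ge_1[of "\<lambda>i. (i, 1) \<in> Y" m] sum_change_ge_1[of "\<lambda>i. (i, n) \<in> Y" m] m1 n1
  by simp_all

text \<open>
Otherwise the other two corners are outside, and the border changes four times.
\<close>

lemma no_opposite_corners:
  assumes "node r K" "few m n (X r K)"
  shows "\<not> ((1, 1) \<in> X r K \<and> (m, n) \<in> X r K)" "\<not> ((1, n) \<in> X r K \<and> (m, 1) \<in> X r K)"
  using assms(2) border_changes[OF assms(1)] mixed_ge_1[of "X r K"] unfolding few_def by linarith+

text \<open>
A region is horizontal if it cuts the left side off the right side, and vertical if it cuts the
top row off the bottom row: it contains exactly the two corners of one side.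
\<close>

definition horizontal :: "cell set \<Rightarrow> bool" where
  "horizontal Y \<longleftrightarrow> ((1, 1) \<in> Y \<longleftrightarrow> (m, 1) \<in> Y) \<and> ((1, n) \<in> Y \<longleftrightarrow> (m, n) \<in> Y) \<and> ((1, 1) \<in> Y \<longleftrightarrow> (1, n) \<notin> Y)"

definition vertical :: "cell set \<Rightarrow> bool" where
  "vertical Y \<longleftrightarrow> ((1, 1) \<in> Y \<longleftrightarrow> (1, n) \<in> Y) \<and> ((m, 1) \<in> Y \<longleftrightarrow> (m, n) \<in> Y) \<and> ((1, 1) \<in> Y \<longleftrightarrow> (m, 1) \<notin> Y)"

definition good_root :: "cell \<Rightarrow> int \<Rightarrow> bool" where
  "good_root r e \<longleftrightarrow> r \<in> rect m n \<and> (e = 1 \<or> e = -1) \<and> (phase r \<noteq> 0 \<longrightarrow> e = phase r) \<and>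
     (\<forall>K. node r K \<longrightarrow> few m n (X r K))"

text \<open>
What the line needs from the root: if a single cell in the interior of the line is left outside
all regions, then it belongs to the component of the root and carries its own phase.
\<close>

definition free_on :: "cell \<Rightarrow> nat \<Rightarrow> (nat \<Rightarrow> cell) \<Rightarrow> bool" where
  "free_on r L g \<longleftrightarrow> (\<exists>k0\<in>{1..L}. (\<forall>K. node r K \<longrightarrow> g k0 \<notin> X r K) \<and>
      (k0 = 1 \<or> k0 = L \<or> (\<exists>K\<in>comps. r \<in> K \<and> g k0 \<in> K)))"

lemma free_on_comp:
  assumes "K \<in> comps" "r \<in> K" "g k \<in> K" "k \<in> {1..L}"
  shows "free_on r L g"
  unfolding free_on_def
proof (intro bexI[OF _ assms(4)] conjI allI impI)
  fix K' assume "node r K'"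
  from root_comp_outside[OF assms(1,2) this] show "g k \<notin> X r K'" using assms(3) by blast
next
  show "k = 1 \<or> k = L \<or> (\<exists>K\<in>comps. r \<in> K \<and> g k \<in> K)" using assms by blast
qed

text \<open>
Start with the root \<open>(1, 1)\<close>. If some region contains the other three corners, take
a minimal such region, cut off by \<open>K\<close>, and move the root into \<open>K\<close>. A
node inside that region keeps its region, which has few corners by minimality; a node outside
now has a region that misses the old one with its three corners. Moreover \<open>K\<close> meets
both the first row and the first column, because \<open>(1, 1)\<close> was separated from the
other ends of them. If the root stays at \<open>(1, 1)\<close>, then it is an end of both lines.
\<close>

lemma good_root_exists:
  obtains r e where "good_root r e" "free_on r n (\<lambda>j. (1, j))" "free_on r m (\<lambda>i. (i, 1))"
proof (cases "\<forall>K. node (1, 1) K \<longrightarrow> few m n (X (1, 1) K)")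
  case True
  define e where "e = (if phase (1, 1) = 0 then 1 else phase (1, 1))"
  have "good_root (1, 1) e"
    using True corners(1) phase_cases[of "(1, 1)"] by (auto simp: good_root_def e_def)
  moreover have "(1, 1) \<notin> X (1, 1) K" for K using root_in_outer by (simp add: inner_def)
  then have "free_on (1, 1) n (\<lambda>j. (1, j))" "free_on (1, 1) m (\<lambda>i. (i, 1))"
    using m1 n1 unfolding free_on_def by (intro bexI[of _ 1]; simp)+
  ultimately show ?thesis using that by blast
next
  case False
  let ?r = "(1::nat, 1::nat)"
  obtain K where K: "node ?r K" "\<not> few m n (X ?r K)"
    and min: "\<And>K'. node ?r K' \<Longrightarrow> \<not> few m n (X ?r K') \<Longrightarrow> card (X ?r K) \<le> card (X ?r K')"
    using False ex_has_least_nat[of "\<lambda>K. node ?r K \<and> \<not> few m n (X ?r K)" _ "\<lambda>K. card (X ?r K)"] by blast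
  note Kc = node_comp[OF K(1)]
  have rX: "?r \<notin> X ?r K" using root_in_outer by (simp add: inner_def)
  have cX: "(1, n) \<in> X ?r K" "(m, 1) \<in> X ?r K" "(m, n) \<in> X ?r K"
    using K(2) rX unfolding few_def by blast+
  obtain r where r: "r \<in> K" using comp_ne[OF Kc] by blast
  have r_rect: "r \<in> rect m n" using comp_sub[OF Kc] r by blast
  define e where "e = phase r"
  have few_r: "few m n (X r K')" if K': "node r K'" for K'
  proof -
    have ne: "K' \<noteq> K" using node_root[OF K'] r by blast
    have dis: "K \<inter> K' = {}" "K' \<inter> K = {}" using comps_disjoint[OF Kc node_comp[OF K']] ne by auto
    have sub: "K' \<subseteq> rect m n - K" using comp_sub[OF node_comp[OF K']] dis by blast
    consider (out) "K' \<subseteq> outer m n ?r K" | (inn) "K' \<subseteq> X ?r K"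
      using conn_cases[OF comp_conn[OF node_comp[OF K']] sub] by blast
    then show ?thesis
    proof cases
      case out
      have "X ?r K \<subseteq> rect m n - K'" using out by (auto simp: inner_def)
      then have "X ?r K \<subseteq> outer m n r K'"
        using conn_subset_outer[OF conn_node[OF K(1)] _ _ root_in_outer] r node_sub[OF K(1)] by blast
      then show ?thesis using cX unfolding few_def inner_def by blast
    next
      case inn
      have r1: "?r \<in> rect m n - K'" using inn rX corners(1) by blast
      then have nd: "node ?r K'" using node_comp[OF K'] by (simp add: node_def)
      note i = inner_mono[OF node_root[OF K(1)] r1 comp_conn[OF Kc] comp_sub[OF Kc] comp_ne[OF Kc]
          comp_sub[OF node_comp[OF K']] dis(1) inn]
      have "r \<in> outer m n ?r K'" using i(2) r by blast
      then have rr: "(?r, r) \<in> reach (rect m n - K')" by (simp add: outer_def)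
      have "outer m n r K' = outer m n ?r K'"
        unfolding outer_def using reach_trans[OF rr] reach_trans[OF reach_sym[OF rr]] by blast
      then have eq: "X r K' = X ?r K'" by (simp add: inner_def)
      have "X ?r K' \<subset> X ?r K" using i r node_sub[OF K(1)] by (auto simp: inner_def)
      then have "card (X ?r K') < card (X ?r K)" by (rule psubset_card_mono[OF finite_X])
      then show ?thesis using min[OF nd] eq by force
    qed
  qed
  have "good_root r e"
    unfolding good_root_def e_def
    using r_rect few_r sgn_cases[OF Kc] comp_phase[OF Kc r] by simp
  moreover have "free_on r n (\<lambda>j. (1, j))"
  proof -
    obtain j where j: "j \<in> {1..<n}" "((1, j) \<in> X ?r K) \<noteq> ((1, Suc j) \<in> X ?r K)"
      using change_exists[of "\<lambda>j. (1, j) \<in> X ?r K" n] rX cX(1) n1 by blast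
    have "(1, j) \<in> rect m n" "(1, Suc j) \<in> rect m n" "adj (1, j) (1, Suc j)" "adj (1, Suc j) (1, j)"
      using j m1 by (auto simp: mem_rect adj_def)
    then have "(1, j) \<in> K \<or> (1, Suc j) \<in> K" using node_boundary(1)[OF K(1)] j(2) by blast
    then show ?thesis using free_on_comp[OF Kc r] j(1) by (metis atLeastAtMost_iff atLeastLessThan_iff
        less_imp_le_nat Suc_leI le_SucI)
  qed
  moreover have "free_on r m (\<lambda>i. (i, 1))"
  proof -
    obtain j where j: "j \<in> {1..<m}" "((j, 1) \<in> X ?r K) \<noteq> ((Suc j, 1) \<in> X ?r K)"
      using change_exists[of "\<lambda>j. (j, 1) \<in> X ?r K" m] rX cX(2) m1 by blast
    have "(j, 1) \<in> rect m n" "(Suc j, 1) \<in> rect m n" "adj (j, 1) (Suc j, 1)" "adj (Suc j, 1) (j, 1)"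
      using j n1 by (auto simp: mem_rect adj_def)
    then have "(j, 1) \<in> K \<or> (Suc j, 1) \<in> K" using node_boundary(1)[OF K(1)] j(2) by blast
    then show ?thesis using free_on_comp[OF Kc r] j(1) by (metis atLeastAtMost_iff atLeastLessThan_iff
        less_imp_le_nat Suc_leI le_SucI)
  qed
  ultimately show ?thesis using that by blast
qed

text \<open>
The colours alternate along the line, so the part of the line inside the region has an excess
equal to the mean of the colours of its two end cells, one of them a corner and the other one at
the end \<open>q\<close>. If that end is bad, then the bound on the doubled excess is odd and
parity gains the missing half.
\<close>

lemma chain_excess:
  fixes g :: "nat \<Rightarrow> cell"
  assumes K: "node r K"
    and g: "inj_on g {1..L}" "\<And>k. 1 \<le> k \<Longrightarrow> k < L \<Longrightarrow> adj (g k) (g (Suc k))"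
    and q: "1 \<le> q" "q < L" "(\<forall>k\<in>{1..L}. g k \<in> X r K \<longleftrightarrow> k \<le> q) \<or> (\<forall>k\<in>{1..L}. g k \<in> X r K \<longleftrightarrow> q < k)"
    and bound: "2 * (sgn_of K * excess (X r K)) + bad_end (X r K) (sgn_of K) (g q) (g (Suc q))
      \<le> 2 * own (X r K) (sgn_of K) (g 1) + 2 * own (X r K) (sgn_of K) (g L)"
  shows "sgn_of K * excess (X r K) \<le> sgn_of K * excess (X r K \<inter> g ` {1..L})"
proof -
  let ?e = "sgn_of K" and ?Y = "X r K"
  have inter: "excess (?Y \<inter> g ` {1..L}) = (\<Sum>k\<in>{a..b}. col (g k))"
    if "1 \<le> a" "b \<le> L" "\<And>k. k \<in> {1..L} \<Longrightarrow> g k \<in> ?Y \<longleftrightarrow> a \<le> k \<and> k \<le> b" for a b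
  proof -
    have "?Y \<inter> g ` {1..L} = g ` {a..b}" using that by fastforce
    moreover have "inj_on g {a..b}" by (rule inj_on_subset[OF g(1)]) (use that in auto)
    ultimately show ?thesis by (simp add: excess_def sum.reindex)
  qed
  have arith: "?e * y \<le> ?e * S"
    if "2 * S = col c0 + col ce" "2 * (?e * y) + of_bool (?e * col ce = -1) \<le> 2 * of_bool (?e * col c0 = 1)"
    for y S c0 ce
    using that sgn_cases[OF node_comp[OF K]] col_cases[of c0] col_cases[of ce] by auto
  from q(3) show ?thesis
  proof
    assume init: "\<forall>k\<in>{1..L}. g k \<in> ?Y \<longleftrightarrow> k \<le> q"
    have S: "2 * excess (?Y \<inter> g ` {1..L}) = col (g 1) + col (g q)"
      using alternating_sum[of 1 q g] inter[of 1 q] init q g(2) by simp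
    have "g 1 \<in> ?Y" "g q \<in> ?Y" "g (Suc q) \<notin> ?Y" "g L \<notin> ?Y" using init q by auto
    then show ?thesis using bound by (intro arith[OF S]) (simp add: bad_end_def own_def)
  next
    assume fin: "\<forall>k\<in>{1..L}. g k \<in> ?Y \<longleftrightarrow> q < k"
    have S: "2 * excess (?Y \<inter> g ` {1..L}) = col (g L) + col (g (Suc q))"
      using alternating_sum[of "Suc q" L g] inter[of "Suc q" L] fin q g(2) by (simp add: Suc_le_eq)
    have "g L \<in> ?Y" "g q \<notin> ?Y" "g (Suc q) \<in> ?Y" "g 1 \<notin> ?Y" using fin q by auto
    then show ?thesis using bound by (intro arith[OF S]) (simp add: bad_end_def own_def)
  qed
qed

section \<open>Bounds for the surplus\<close>

lemma bad_ends_nonneg: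
  "0 \<le> (\<Sum>i\<in>{1..<m}. bad_end Y s (i, 1) (Suc i, 1))" "0 \<le> (\<Sum>j\<in>{1..<n}. bad_end Y s (1, j) (1, Suc j))"
  by (intro sum_nonneg bad_end_nonneg)+

lemma pocket_excess:
  assumes "node r K" "own (X r K) (sgn_of K) (1, 1) + own (X r K) (sgn_of K) (1, n)
      + own (X r K) (sgn_of K) (m, 1) + own (X r K) (sgn_of K) (m, n) \<le> 1"
  shows "sgn_of K * excess (X r K) \<le> 0"
  using node_excess[OF assms(1)] assms(2) bad_ends_nonneg[of "X r K" "sgn_of K"] by linarith

lemma surplus_le_line_length:
  fixes g :: "nat \<Rightarrow> cell"
  assumes root: "good_root r e" and free: "free_on r L g"
    and g: "inj_on g {1..L}" "\<And>k. k \<in> {1..L} \<Longrightarrow> g k \<in> rect m n"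
      "\<And>k. adj (g k) (g (Suc k))"
    and excess: "excess (rect m n) = excess (g ` {1..L})"
    and up: "\<And>K K'. node r K \<Longrightarrow> node r K' \<Longrightarrow> ch K \<Longrightarrow> X r K \<subset> X r K' \<Longrightarrow> ch K'"
    and pocket: "\<And>K. node r K \<Longrightarrow> \<not> ch K \<Longrightarrow>
      own (X r K) (sgn_of K) (1, 1) + own (X r K) (sgn_of K) (1, n)
      + own (X r K) (sgn_of K) (m, 1) + own (X r K) (sgn_of K) (m, n) \<le> 1"
    and seg: "\<And>K. node r K \<Longrightarrow> ch K \<Longrightarrow> \<exists>q\<ge>1. q < L \<and>
      ((\<forall>k\<in>{1..L}. g k \<in> X r K \<longleftrightarrow> k \<le> q) \<or> (\<forall>k\<in>{1..L}. g k \<in> X r K \<longleftrightarrow> q < k))"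
    and bound: "\<And>K q. node r K \<Longrightarrow> ch K \<Longrightarrow> 1 \<le> q \<Longrightarrow> q < L \<Longrightarrow>
      2 * (sgn_of K * excess (X r K)) + bad_end (X r K) (sgn_of K) (g q) (g (Suc q))
      \<le> 2 * own (X r K) (sgn_of K) (g 1) + 2 * own (X r K) (sgn_of K) (g L)"
  shows "surplus \<le> int L - 2 * int (L div 3)"
proof -
  have r: "r \<in> rect m n" "e = 1 \<or> e = -1" "phase r \<noteq> 0 \<Longrightarrow> e = phase r"
    using root by (auto simp: good_root_def)
  have chain: "sgn_of K * excess (X r K) \<le> sgn_of K * excess (X r K \<inter> g ` {1..L})"
    if K: "node r K" "ch K" for K
  proof -
    obtain q where q: "1 \<le> q" "q < L"
      "(\<forall>k\<in>{1..L}. g k \<in> X r K \<longleftrightarrow> k \<le> q) \<or> (\<forall>k\<in>{1..L}. g k \<in> X r K \<longleftrightarrow> q < k)"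
      using seg[OF K] by blast
    show ?thesis by (rule chain_excess[OF K(1) g(1,3) q bound[OF K q(1,2)]])
  qed
  have "\<exists>C. set C = {K. node r K \<and> ch K} \<and> sorted_wrt (nested r) C \<and>
      surplus \<le> weight (g ` {1..L}) (paint (X r) sgn_of e C)"
  proof (rule surplus_le_line[OF r(1,3,2), where ch = ch])
    show "\<And>K K'. node r K \<Longrightarrow> node r K' \<Longrightarrow> ch K \<Longrightarrow> X r K \<subset> X r K' \<Longrightarrow> ch K'"
      by (rule up)
    show "\<And>K. node r K \<Longrightarrow> \<not> ch K \<Longrightarrow> sgn_of K * excess (X r K) \<le> 0"
      by (rule pocket_excess[OF _ pocket])
    show "finite (g ` {1..L})" by simp
    show "excess (rect m n) = excess (g ` {1..L})" by (rule excess)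
    show "\<And>K. node r K \<Longrightarrow> ch K \<Longrightarrow>
      sgn_of K * excess (X r K) \<le> sgn_of K * excess (X r K \<inter> g ` {1..L})"
      by (rule chain)
  qed
  then obtain C where C: "set C = {K. node r K \<and> ch K}" "sorted_wrt (nested r) C"
    "surplus \<le> weight (g ` {1..L}) (paint (X r) sgn_of e C)"
    by (elim exE conjE)
  have "weight (g ` {1..L}) (paint (X r) sgn_of e C) \<le> int L - 2 * int (L div 3)"
    by (rule line_bound[OF C(1,2) r(3,2) g(2,1,3) seg free[unfolded free_on_def]])
  then show ?thesis using C(3) by linarith
qed

text \<open>
As \<open>m\<close> is odd, the two corners on the left side have the same colour, and so do the
two corners on the right side. Hence a horizontal region may have two corners of its own colour;
it joins top to bottom, and meets the first row in an initial or a final segment. Every other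
region has at most one corner of its own colour.
\<close>

lemma surplus_le_row:
  assumes root: "good_root r e" and free: "free_on r n (\<lambda>j. (1, j))" and odd: "odd m"
    and no_vertical: "odd n \<Longrightarrow> (\<And>K. node r K \<Longrightarrow> \<not> vertical (X r K))"
  shows "surplus \<le> int n - 2 * int (n div 3)"
proof (rule surplus_le_line_length[OF root free, where ch = "\<lambda>K. horizontal (X r K)"])
  have few: "\<And>K. node r K \<Longrightarrow> few m n (X r K)"
    using root by (simp add: good_root_def)
  have colc: "col (1, 1) = 1" "col (m, 1) = 1" "col (m, n) = col (1, n)"
    "col (1, n) = (if odd n then 1 else -1)"
    using odd by (auto simp: col_def)
  show "inj_on (\<lambda>j. (1, j)) {1..n}" "\<And>k. k \<in> {1..n} \<Longrightarrow> (\<lambda>j. (1, j)) k \<in> rect m n"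
    "\<And>k. adj ((\<lambda>j. (1, j)) k) ((\<lambda>j. (1, j)) (Suc k))"
    using m1 by (auto simp: inj_on_def mem_rect adj_def)
  show "excess (rect m n) = excess ((\<lambda>j. (1, j)) ` {1..n})"
    unfolding excess_rect excess_row using odd by (simp add: odd_iff_mod_2_eq_one)
  fix K assume K: "node r K"
  show "horizontal (X r K')" if "node r K'" "horizontal (X r K)" "X r K \<subset> X r K'" for K'
    using few[OF that(1)] that(2,3) unfolding horizontal_def few_def by blast
  show "own (X r K) (sgn_of K) (1, 1) + own (X r K) (sgn_of K) (1, n)
      + own (X r K) (sgn_of K) (m, 1) + own (X r K) (sgn_of K) (m, n) \<le> 1"
    if "\<not> horizontal (X r K)"
  proof -
    have "\<not> vertical (X r K)" if "col (1, n) = 1"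
      using no_vertical[OF _ K] that unfolding colc(4) by (simp split: if_splits)
    then have "of_bool ((1, 1) \<in> X r K \<and> sgn_of K = 1) + of_bool ((1, n) \<in> X r K \<and> sgn_of K * col (1, n) = 1)
      + of_bool ((m, 1) \<in> X r K \<and> sgn_of K = 1) + of_bool ((m, n) \<in> X r K \<and> sgn_of K * col (1, n) = 1) \<le> (1::int)"
      using that no_opposite_corners[OF K few[OF K]] unfolding horizontal_def vertical_def
      by (intro at_most_one_own_corner sgn_cases[OF node_comp[OF K]] col_cases) blast+
    then show ?thesis unfolding own_def colc(1-3) mult_1_right by linarith
  qed
  assume ch: "horizontal (X r K)"
  have dif: "((1, 1) \<in> X r K) \<noteq> ((1, n) \<in> X r K)" "((m, 1) \<in> X r K) \<noteq> ((m, n) \<in> X r K)"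
    using ch unfolding horizontal_def by blast+
  have "0 \<le> (\<Sum>i\<in>{1..<m}. mixed (X r K) (i, 1) (Suc i, 1))" "0 \<le> (\<Sum>i\<in>{1..<m}. mixed (X r K) (i, n) (Suc i, n))"
    by (intro sum_nonneg mixed_nonneg)+
  then have "(\<Sum>j\<in>{1..<n}. mixed (X r K) (1, j) (1, Suc j)) \<le> 1"
    using border_changes[OF K] mixed_ge_1(2)[OF dif(2)] by linarith
  then show "\<exists>q\<ge>1. q < n \<and> ((\<forall>k\<in>{1..n}. (\<lambda>j. (1, j)) k \<in> X r K \<longleftrightarrow> k \<le> q)
      \<or> (\<forall>k\<in>{1..n}. (\<lambda>j. (1, j)) k \<in> X r K \<longleftrightarrow> q < k))"
    using dif(1) n1 unfolding mixed_def by (intro single_change_segment[of "\<lambda>j. (1, j) \<in> X r K"])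
  fix q assume q: "1 \<le> q" "q < n"
  have "bad_end (X r K) (sgn_of K) (1, q) (1, Suc q) \<le> sum (\<lambda>j. bad_end (X r K) (sgn_of K) (1, j) (1, Suc j)) {1..<n}"
    by (rule member_le_sum[of q _ "\<lambda>j. bad_end (X r K) (sgn_of K) (1, j) (1, Suc j)"]) (use q bad_end_nonneg in auto)
  moreover have "own (X r K) (sgn_of K) (m, 1) = own (X r K) (sgn_of K) (1, 1)"
    "own (X r K) (sgn_of K) (m, n) = own (X r K) (sgn_of K) (1, n)"
    using ch unfolding horizontal_def own_def colc(1-3) by simp_all
  ultimately show "2 * (sgn_of K * excess (X r K)) + bad_end (X r K) (sgn_of K) ((\<lambda>j. (1, j)) q) ((\<lambda>j. (1, j)) (Suc q))
      \<le> 2 * own (X r K) (sgn_of K) ((\<lambda>j. (1, j)) 1) + 2 * own (X r K) (sgn_of K) ((\<lambda>j. (1, j)) n)"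
    using node_excess[OF K] bad_ends_nonneg[of "X r K" "sgn_of K"] by linarith
qed

text \<open>
The same argument with the sides exchanged.
\<close>

lemma surplus_le_column:
  assumes root: "good_root r e" and free: "free_on r m (\<lambda>i. (i, 1))" and odd: "odd n"
    and no_horizontal: "odd m \<Longrightarrow> (\<And>K. node r K \<Longrightarrow> \<not> horizontal (X r K))"
  shows "surplus \<le> int m - 2 * int (m div 3)"
proof (rule surplus_le_line_length[OF root free, where ch = "\<lambda>K. vertical (X r K)"])
  have few: "\<And>K. node r K \<Longrightarrow> few m n (X r K)"
    using root by (simp add: good_root_def)
  have colc: "col (1, 1) = 1" "col (1, n) = 1" "col (m, n) = col (m, 1)"
    "col (m, 1) = (if odd m then 1 else -1)"
    using odd by (auto simp: col_def)
  show "inj_on (\<lambda>i. (i, 1)) {1..m}" "\<And>k. k \<in> {1..m} \<Longrightarrow> (\<lambda>i. (i, 1)) k \<in> rect m n"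
    "\<And>k. adj ((\<lambda>i. (i, 1)) k) ((\<lambda>i. (i, 1)) (Suc k))"
    using n1 by (auto simp: inj_on_def mem_rect adj_def)
  show "excess (rect m n) = excess ((\<lambda>i. (i, 1)) ` {1..m})"
    unfolding excess_rect excess_column using odd by (simp add: odd_iff_mod_2_eq_one)
  fix K assume K: "node r K"
  show "vertical (X r K')" if "node r K'" "vertical (X r K)" "X r K \<subset> X r K'" for K'
    using few[OF that(1)] that(2,3) unfolding vertical_def few_def by blast
  show "own (X r K) (sgn_of K) (1, 1) + own (X r K) (sgn_of K) (1, n)
      + own (X r K) (sgn_of K) (m, 1) + own (X r K) (sgn_of K) (m, n) \<le> 1"
    if "\<not> vertical (X r K)"
  proof -
    have "\<not> horizontal (X r K)" if "col (m, 1) = 1"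
      using no_horizontal[OF _ K] that unfolding colc(4) by (simp split: if_splits)
    then have "of_bool ((1, 1) \<in> X r K \<and> sgn_of K = 1) + of_bool ((m, 1) \<in> X r K \<and> sgn_of K * col (m, 1) = 1)
      + of_bool ((1, n) \<in> X r K \<and> sgn_of K = 1) + of_bool ((m, n) \<in> X r K \<and> sgn_of K * col (m, 1) = 1) \<le> (1::int)"
      using that no_opposite_corners[OF K few[OF K]] unfolding vertical_def horizontal_def
      by (intro at_most_one_own_corner sgn_cases[OF node_comp[OF K]] col_cases) blast+
    then show ?thesis unfolding own_def colc(1-3) mult_1_right by linarith
  qed
  assume ch: "vertical (X r K)"
  have dif: "((1, 1) \<in> X r K) \<noteq> ((m, 1) \<in> X r K)" "((1, n) \<in> X r K) \<noteq> ((m, n) \<in> X r K)"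
    using ch unfolding vertical_def by blast+
  have "0 \<le> (\<Sum>j\<in>{1..<n}. mixed (X r K) (1, j) (1, Suc j))" "0 \<le> (\<Sum>j\<in>{1..<n}. mixed (X r K) (m, j) (m, Suc j))"
    by (intro sum_nonneg mixed_nonneg)+
  then have "(\<Sum>i\<in>{1..<m}. mixed (X r K) (i, 1) (Suc i, 1)) \<le> 1"
    using border_changes[OF K] mixed_ge_1(4)[OF dif(2)] by linarith
  then show "\<exists>q\<ge>1. q < m \<and> ((\<forall>k\<in>{1..m}. (\<lambda>i. (i, 1)) k \<in> X r K \<longleftrightarrow> k \<le> q)
      \<or> (\<forall>k\<in>{1..m}. (\<lambda>i. (i, 1)) k \<in> X r K \<longleftrightarrow> q < k))"
    using dif(1) m1 unfolding mixed_def by (intro single_change_segment[of "\<lambda>i. (i, 1) \<in> X r K"])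
  fix q assume q: "1 \<le> q" "q < m"
  have "bad_end (X r K) (sgn_of K) (q, 1) (Suc q, 1) \<le> sum (\<lambda>i. bad_end (X r K) (sgn_of K) (i, 1) (Suc i, 1)) {1..<m}"
    by (rule member_le_sum[of q _ "\<lambda>i. bad_end (X r K) (sgn_of K) (i, 1) (Suc i, 1)"]) (use q bad_end_nonneg in auto)
  moreover have "own (X r K) (sgn_of K) (1, n) = own (X r K) (sgn_of K) (1, 1)"
    "own (X r K) (sgn_of K) (m, n) = own (X r K) (sgn_of K) (m, 1)"
    using ch unfolding vertical_def own_def colc(1-3) by simp_all
  ultimately show "2 * (sgn_of K * excess (X r K)) + bad_end (X r K) (sgn_of K) ((\<lambda>i. (i, 1)) q) ((\<lambda>i. (i, 1)) (Suc q))
      \<le> 2 * own (X r K) (sgn_of K) ((\<lambda>i. (i, 1)) 1) + 2 * own (X r K) (sgn_of K) ((\<lambda>i. (i, 1)) m)"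
    using node_excess[OF K] bad_ends_nonneg[of "X r K" "sgn_of K"] by linarith
qed

text \<open>
Adjacent corners have different colours, so every region has at most one corner of its own
colour and can be dropped; the background has excess \<open>0\<close>.
\<close>

lemma surplus_even_even:
  assumes "even m" "even n"
  shows "surplus \<le> 0"
proof -
  obtain r e where gr: "good_root r e" using good_root_exists by blast
  have r: "r \<in> rect m n" "e = 1 \<or> e = -1" "phase r \<noteq> 0 \<Longrightarrow> e = phase r"
    and few: "\<And>K. node r K \<Longrightarrow> few m n (X r K)"
    using gr by (auto simp: good_root_def)
  have colc: "col (1, 1) = 1" "col (m, n) = 1" "col (1, n) = -1" "col (m, 1) = -1"
    using assms by (auto simp: col_def)
  have pocket: "sgn_of K * excess (X r K) \<le> 0" if K: "node r K" for K
  proof (rule pocket_excess[OF K])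
    show "own (X r K) (sgn_of K) (1, 1) + own (X r K) (sgn_of K) (1, n)
      + own (X r K) (sgn_of K) (m, 1) + own (X r K) (sgn_of K) (m, n) \<le> 1"
      using no_opposite_corners[OF K few[OF K]] sgn_cases[OF node_comp[OF K]]
      unfolding own_def colc by auto
  qed
  have "excess (rect m n) = excess {}"
    unfolding excess_rect using assms by (simp add: excess_def even_iff_mod_2_eq_zero)
  then have "\<exists>C. set C = {K. node r K \<and> False} \<and> sorted_wrt (nested r) C \<and>
      surplus \<le> weight {} (paint (X r) sgn_of e C)"
    by (intro surplus_le_line[OF r(1,3,2)] pocket) simp_all
  then show ?thesis by (simp add: weight_def)
qed

text \<open>
If both sides are odd, then horizontal and vertical regions cannot both occur: they would share
a corner, hence be nested by laminarity, and the larger one would contain three corners.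
\<close>

theorem surplus_bound:
  shows "odd m \<Longrightarrow> even n \<Longrightarrow> surplus \<le> int n - 2 * int (n div 3)"
    and "even m \<Longrightarrow> odd n \<Longrightarrow> surplus \<le> int m - 2 * int (m div 3)"
    and "odd m \<Longrightarrow> odd n \<Longrightarrow> surplus \<le> max (int n - 2 * int (n div 3)) (int m - 2 * int (m div 3))"
proof -
  obtain r e where root: "good_root r e" "free_on r n (\<lambda>j. (1, j))" "free_on r m (\<lambda>i. (i, 1))"
    by (rule good_root_exists)
  show "odd m \<Longrightarrow> even n \<Longrightarrow> surplus \<le> int n - 2 * int (n div 3)"
    by (rule surplus_le_row[OF root(1,2)]) simp_all
  show "even m \<Longrightarrow> odd n \<Longrightarrow> surplus \<le> int m - 2 * int (m div 3)"
    by (rule surplus_le_column[OF root(1,3)]) simp_all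
  assume odd: "odd m" "odd n"
  show "surplus \<le> max (int n - 2 * int (n div 3)) (int m - 2 * int (m div 3))"
  proof (cases "\<exists>K. node r K \<and> vertical (X r K)")
    case False
    then have "\<not> vertical (X r K)" if "node r K" for K using that by blast
    then have "surplus \<le> int n - 2 * int (n div 3)"
      by (rule surplus_le_row[OF root(1,2) odd(1)])
    then show ?thesis by linarith
  next
    case True
    then obtain K where K: "node r K" "vertical (X r K)" by blast
    have "\<not> horizontal (X r K')" if K': "node r K'" for K'
    proof
      assume h: "horizontal (X r K')"
      have few: "few m n (X r K)" "few m n (X r K')" using root(1) K(1) K' by (simp_all add: good_root_def)
      have ne: "K \<noteq> K'" using h K(2) unfolding horizontal_def vertical_def by blast
      have "\<exists>c\<in>{(1, 1), (1, n), (m, 1), (m, n)}. c \<in> X r K \<and> c \<in> X r K'"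
        using h K(2) unfolding horizontal_def vertical_def by auto
      then have "X r K \<inter> X r K' \<noteq> {}" by blast
      then have "X r K' \<subset> X r K \<or> X r K \<subset> X r K'" using node_laminar[OF K(1) K' ne] by blast
      then show False
      proof
        assume "X r K' \<subset> X r K"
        then have "c \<in> X r K' \<Longrightarrow> c \<in> X r K" for c by blast
        from this[of "(1, 1)"] this[of "(1, n)"] this[of "(m, 1)"] this[of "(m, n)"]
        show False using few h K(2) unfolding few_def horizontal_def vertical_def by argo
      next
        assume "X r K \<subset> X r K'"
        then have "c \<in> X r K \<Longrightarrow> c \<in> X r K'" for c by blast
        from this[of "(1, 1)"] this[of "(1, n)"] this[of "(m, 1)"] this[of "(m, n)"]
        show False using few h K(2) unfolding few_def horizontal_def vertical_def by argo
      qed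
    qed
    then have "surplus \<le> int m - 2 * int (m div 3)"
      by (rule surplus_le_column[OF root(1,3) odd(2)])
    then show ?thesis by linarith
  qed
qed

end

section \<open>The upper bound for grids\<close>

lemma path_edge: "{b, b'} \<in> edges (path_graph k) \<longleftrightarrow> b \<in> {1..k} \<and> b' \<in> {1..k} \<and> (b' = Suc b \<or> b = Suc b')"
  by (auto simp: path_graph_def doubleton_eq_iff)

lemma verts_grid: "verts (grid m n) = rect m n"
  by (simp add: grid_def cartesian_product_def path_graph_def rect_def)

lemma edge_grid: "{u, v} \<in> edges (grid m n) \<longleftrightarrow> u \<in> rect m n \<and> v \<in> rect m n \<and> adj u v"
proof -
  obtain a b c d where uv: "u = (a, b)" "v = (c, d)" by (cases u, cases v)
  have "{u, v} \<in> edges (grid m n) \<longleftrightarrow>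
      a = c \<and> a \<in> {1..m} \<and> {b, d} \<in> edges (path_graph n) \<or> b = d \<and> b \<in> {1..n} \<and> {a, c} \<in> edges (path_graph m)"
    unfolding grid_def cartesian_product_def uv
    by (auto simp: doubleton_eq_iff path_graph_def) (metis insert_commute)+
  then show ?thesis by (auto simp: path_edge uv mem_rect adj_def)
qed

lemma edge_grid_ends:
  assumes "e \<in> edges (grid m n)"
  shows "\<exists>u v. e = {u, v} \<and> u \<in> rect m n \<and> v \<in> rect m n \<and> adj u v"
proof -
  have "card e = 2" using assms simple_graph_grid[of m n] by (auto simp: simple_graph_def)
  then obtain u v where "e = {u, v}" by (auto simp: card_2_iff)
  then show ?thesis using edge_grid[of u v m n] assms by blast
qed

lemma nbhd_grid: "t \<in> rect m n \<Longrightarrow> nbhd (grid m n) t = {u \<in> rect m n. adj t u}"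
  by (auto simp: nbhd_def verts_grid edge_grid intro: adj_sym)

lemma omega_pair_packing:
  assumes mn: "m \<ge> 1" "n \<ge> 1" and TM: "omega_pair (grid m n) T M"
  shows "packing m n T M"
proof
  show "m \<ge> 1" "n \<ge> 1" by (rule mn)+
  show T: "T \<subseteq> rect m n" using TM by (simp add: omega_pair_def verts_grid)
  show "\<exists>u v. e = {u, v} \<and> u \<in> rect m n \<and> v \<in> rect m n \<and> adj u v" if "e \<in> M" for e
    by (rule edge_grid_ends) (use that TM in \<open>auto simp: omega_pair_def matching_def\<close>)
  show "e \<inter> e' = {}" if "e \<in> M" "e' \<in> M" "e \<noteq> e'" for e e'
    using that TM unfolding omega_pair_def matching_def by blast
  show "T \<inter> \<Union>M = {}" using TM unfolding omega_pair_def by blast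
  show "d = d'" if "t \<in> T" "d \<in> T \<union> \<Union>M" "d' \<in> T \<union> \<Union>M" "adj t d" "adj t d'" for t d d'
  proof -
    have t: "t \<in> rect m n" using that(1) T by blast
    have M: "\<Union>M \<subseteq> rect m n"
    proof (rule Union_least)
      fix e assume "e \<in> M"
      then have "e \<in> edges (grid m n)" using TM by (auto simp: omega_pair_def matching_def)
      from edge_grid_ends[OF this] show "e \<subseteq> rect m n" by auto
    qed
    let ?N = "nbhd (grid m n) t \<inter> (T \<union> \<Union>M)"
    have "finite ?N" unfolding nbhd_grid[OF t] using finite_rect[of m n] by (auto intro: finite_subset)
    moreover have "card ?N \<le> Suc 0" using TM that(1) by (auto simp: omega_pair_def)
    moreover have "d \<in> ?N" "d' \<in> ?N" unfolding nbhd_grid[OF t] using that T M by blast+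
    ultimately show ?thesis using card_le_Suc0_iff_eq by blast
  qed
qed

lemma ceil_half: "\<lceil>real n / 2\<rceil> = int (n - n div 2)"
proof -
  have "real n = 2 * real (n div 2) + real (n mod 2)" by (metis mult_div_mod_eq of_nat_add of_nat_mult of_nat_numeral)
  moreover have "real (n - n div 2) = real n - real (n div 2)" by (simp add: of_nat_diff)
  moreover have "n mod 2 = 0 \<or> n mod 2 = 1" by auto
  ultimately show ?thesis by (intro ceiling_unique) auto
qed

lemma floor_half: "\<lfloor>real n / 2\<rfloor> = int (n div 2)"
  using floor_divide_of_nat_eq[of n 2] by simp

lemma floor_third: "\<lfloor>real n / 3\<rfloor> = int (n div 3)"
  using floor_divide_of_nat_eq[of n 3] by simp

lemma third_cases: "n mod 3 = 0 \<or> n mod 3 = 1 \<or> n mod (3::nat) = 2"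
  by presburger

lemma real_third: "real n = 3 * real (n div 3) + real (n mod 3)"
  by (metis mult_div_mod_eq of_nat_add of_nat_mult of_nat_numeral)

lemma ceil_two_thirds: "\<lceil>2 * real n / 3\<rceil> = int (n - n div 3)"
proof -
  have "real (n - n div 3) = real n - real (n div 3)" by (simp add: of_nat_diff)
  then show ?thesis using real_third[of n] third_cases[of n] by (intro ceiling_unique) auto
qed

lemma ceil_five_thirds: "\<lceil>5 * real n / 3\<rceil> = int (2 * n - n div 3)"
proof -
  have "n div 3 \<le> 2 * n" by linarith
  then have "real (2 * n - n div 3) = 2 * real n - real (n div 3)" by (simp add: of_nat_diff)
  then show ?thesis using real_third[of n] third_cases[of n] by (intro ceiling_unique) auto
qed

text \<open>
The two terms of the maximum that defines \<open>F\<close>, without rounding of real numbers.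
\<close>

definition strip_count :: "nat \<Rightarrow> nat \<Rightarrow> nat" where
  "strip_count m n = (m - m div 2) * (n - n div 3) + (m div 2) * (n div 3)"

lemma F_eq: "F m n = int (max (strip_count m n) (strip_count n m))"
  by (simp add: F_def strip_count_def ceil_half floor_half floor_third ceil_two_thirds of_nat_max)

lemma twice_strip_count:
  "2 * int (strip_count m n) = int (m * n) + (if odd m then int n - 2 * int (n div 3) else 0)"
proof -
  have d: "int (n - n div 3) = int n - int (n div 3)" by (simp add: of_nat_diff)
  show ?thesis
  proof (cases "even m")
    case True
    then obtain a where a: "m = 2 * a" by (elim evenE)
    have "m - m div 2 = a" "m div 2 = a" using a by simp_all
    then have "int (strip_count m n) = int a * (int n - int (n div 3)) + int a * int (n div 3)"
      by (simp only: strip_count_def of_nat_add of_nat_mult d)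
    then show ?thesis using True by (simp add: a algebra_simps)
  next
    case False
    then obtain a where a: "m = 2 * a + 1" by (elim oddE)
    have "m - m div 2 = a + 1" "m div 2 = a" using a by simp_all
    then have "int (strip_count m n) = (int a + 1) * (int n - int (n div 3)) + int a * int (n div 3)"
      by (simp only: strip_count_def of_nat_add of_nat_mult of_nat_1 d)
    then show ?thesis using False by (simp add: a algebra_simps)
  qed
qed

lemma omega_pair_le:
  assumes mn: "m \<ge> 1" "n \<ge> 1" and TM: "omega_pair (grid m n) T M"
  shows "card T + card M \<le> max (strip_count m n) (strip_count n m)"
proof -
  interpret packing m n T M by (rule omega_pair_packing[OF assms])
  have "int (m * n) + surplus \<le> 2 * int (strip_count m n) \<or> int (m * n) + surplus \<le> 2 * int (strip_count n m)"
  proof (cases "even m")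
    case m: True
    show ?thesis
    proof (cases "even n")
      case True
      have "surplus \<le> 0" by (rule surplus_even_even[OF m True])
      then show ?thesis using m by (simp add: twice_strip_count)
    next
      case False
      have "surplus \<le> int m - 2 * int (m div 3)" by (rule surplus_bound(2)[OF m False])
      then show ?thesis using False by (simp add: twice_strip_count)
    qed
  next
    case m: False
    show ?thesis
    proof (cases "even n")
      case True
      have "surplus \<le> int n - 2 * int (n div 3)" by (rule surplus_bound(1)[OF m True])
      then show ?thesis using m by (simp add: twice_strip_count)
    next
      case False
      have "surplus \<le> max (int n - 2 * int (n div 3)) (int m - 2 * int (m div 3))"
        by (rule surplus_bound(3)[OF m False])
      then consider "surplus \<le> int n - 2 * int (n div 3)" | "surplus \<le> int m - 2 * int (m div 3)"
        unfolding le_max_iff_disj by (elim disjE)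
      then show ?thesis
      proof cases
        case 1
        have "2 * int (strip_count m n) = int (m * n) + (int n - 2 * int (n div 3))"
          using m by (simp add: twice_strip_count)
        then show ?thesis using 1 by (intro disjI1) linarith
      next
        case 2
        have "2 * int (strip_count n m) = int (m * n) + (int m - 2 * int (m div 3))"
          using False by (simp add: twice_strip_count)
        then show ?thesis using 2 by (intro disjI2) linarith
      qed
    qed
  qed
  then have "2 * (int (card T) + int (card M)) \<le> 2 * int (strip_count m n) \<or>
      2 * (int (card T) + int (card M)) \<le> 2 * int (strip_count n m)"
    by (simp only: surplus_weight)
  then have "card T + card M \<le> strip_count m n \<or> card T + card M \<le> strip_count n m"
    unfolding of_nat_add[symmetric] mult_le_cancel_left_pos[OF zero_less_numeral] of_nat_le_iff .
  then show ?thesis unfolding le_max_iff_disj .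
qed

section \<open>Large 2-independent sets\<close>

text \<open>
Odd rows repeat the pattern of two chosen cells and a gap; even rows contain only the cells
below the gaps.
\<close>

definition stripes :: "nat \<Rightarrow> nat \<Rightarrow> cell set" where
  "stripes m n = {(i, j) \<in> rect m n. odd i \<longleftrightarrow> j mod 3 \<noteq> 0}"

lemma two_independent_grid:
  assumes "S \<subseteq> rect m n" "\<And>v. v \<in> S \<Longrightarrow> \<exists>w. \<forall>u\<in>S. adj v u \<longrightarrow> u = w"
  shows "two_independent (grid m n) S"
  unfolding two_independent_def verts_grid degree_def
proof (intro conjI ballI)
  fix v assume v: "v \<in> S"
  obtain w where w: "\<forall>u\<in>S. adj v u \<longrightarrow> u = w" using assms(2)[OF v] by blast
  have "nbhd (induced_subgraph (grid m n) S) v \<subseteq> {w}"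
    using w by (auto simp: nbhd_def induced_subgraph_def edge_grid dest: adj_sym)
  then show "card (nbhd (induced_subgraph (grid m n) S) v) \<le> 1"
    using card_mono[of "{w}"] by simp
qed (rule assms(1))

lemma card_filter_Suc:
  "card {i \<in> {1..Suc m}. P i} = card {i \<in> {1..m}. P i} + of_bool (P (Suc m))"
proof -
  have "{i \<in> {1..Suc m}. P i} = (if P (Suc m) then insert (Suc m) {i \<in> {1..m}. P i} else {i \<in> {1..m}. P i})"
    by (auto simp: le_Suc_eq)
  then show ?thesis by simp
qed

lemma card_even: "card {i \<in> {1..m}. even i} = m div 2"
proof (induction m)
  case (Suc m)
  have "m div 2 + of_bool (even (Suc m)) = Suc m div 2"
    unfolding of_bool_def by presburger
  then show ?case unfolding card_filter_Suc Suc.IH .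
qed simp

lemma card_odd: "card {i \<in> {1..m}. odd i} = m - m div 2"
proof (induction m)
  case (Suc m)
  have "m - m div 2 + of_bool (odd (Suc m)) = Suc m - Suc m div 2"
    unfolding of_bool_def by presburger
  then show ?case unfolding card_filter_Suc Suc.IH .
qed simp

lemma card_div3: "card {i \<in> {1..m}. i mod 3 = 0} = m div 3"
proof (induction m)
  case (Suc m)
  have "m div 3 + of_bool (Suc m mod 3 = 0) = Suc m div 3"
    unfolding of_bool_def by presburger
  then show ?case unfolding card_filter_Suc Suc.IH .
qed simp

lemma card_not_div3: "card {i \<in> {1..m}. i mod 3 \<noteq> 0} = m - m div 3"
proof (induction m)
  case (Suc m)
  have "m div 3 \<le> m" by (rule div_le_dividend)
  then have "m - m div 3 + of_bool (Suc m mod 3 \<noteq> 0) = Suc m - Suc m div 3"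
    by (cases "Suc m mod 3 = 0") (simp_all add: div_Suc Suc_diff_le)
  then show ?case unfolding card_filter_Suc Suc.IH .
qed simp

lemma card_stripes: "card (stripes m n) = strip_count m n"
proof -
  define O' where "O' = {i \<in> {1..m}. odd i}"
  define E' where "E' = {i \<in> {1..m}. even i}"
  define A where "A = {j \<in> {1..n}. j mod 3 \<noteq> 0}"
  define B where "B = {j \<in> {1..n}. j mod 3 = 0}"
  have fin: "finite O'" "finite E'" "finite A" "finite B"
    by (simp_all only: O'_def E'_def A_def B_def finite_Collect_conjI finite_atLeastAtMost Collect_mem_eq simp_thms)
  have "O' \<inter> E' = {}" unfolding O'_def E'_def by blast
  then have "(O' \<times> A) \<inter> (E' \<times> B) = {}" by blast
  then have "card (O' \<times> A \<union> E' \<times> B) = card O' * card A + card E' * card B"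
    using fin by (simp add: card_Un_disjoint card_cartesian_product)
  moreover have "stripes m n = O' \<times> A \<union> E' \<times> B"
    unfolding O'_def E'_def A_def B_def stripes_def rect_def by auto
  moreover have "card O' = m - m div 2" "card E' = m div 2" "card A = n - n div 3" "card B = n div 3"
    unfolding O'_def E'_def A_def B_def by (rule card_odd card_even card_not_div3 card_div3)+
  ultimately show ?thesis by (simp add: strip_count_def)
qed

lemma stripes_nbr:
  assumes "(i, j) \<in> stripes m n" "u \<in> stripes m n" "adj (i, j) u"
  shows "u = (if j mod 3 = 1 then (i, Suc j) else (i, j - 1))"
proof -
  obtain a b where u: "u = (a, b)" by (cases u)
  have i: "odd i \<longleftrightarrow> j mod 3 \<noteq> 0" and a: "odd a \<longleftrightarrow> b mod 3 \<noteq> 0"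
    using assms(1,2) unfolding u stripes_def by simp_all
  consider "a = i" "b = Suc j" | "a = i" "j = Suc b" | "b = j" "a = Suc i \<or> i = Suc a"
    using assms(3) unfolding u adj_def by auto
  then show ?thesis
  proof cases
    case 1
    then have "j mod 3 \<noteq> 0 \<longleftrightarrow> Suc j mod 3 \<noteq> 0" using i a by simp
    then have "j mod 3 = 1" by presburger
    then show ?thesis using 1 u by simp
  next
    case 2
    then have "b mod 3 \<noteq> 0 \<longleftrightarrow> Suc b mod 3 \<noteq> 0" using i a by simp
    then have "Suc b mod 3 \<noteq> 1" by presburger
    then show ?thesis using 2 u by simp
  next
    case 3
    then show ?thesis using i a by auto
  qed
qed

lemma two_independent_stripes: "two_independent (grid m n) (stripes m n)"
proof (rule two_independent_grid)
  show "stripes m n \<subseteq> rect m n" by (auto simp: stripes_def)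
  fix v assume "v \<in> stripes m n"
  then show "\<exists>w. \<forall>u\<in>stripes m n. adj v u \<longrightarrow> u = w"
    using stripes_nbr[of "fst v" "snd v" m n] unfolding prod.collapse by blast
qed

lemma adj_swap: "adj (prod.swap c) (prod.swap d) \<longleftrightarrow> adj c d"
  by (auto simp: adj_def)

lemma two_independent_stripes_swap: "two_independent (grid m n) (prod.swap ` stripes n m)"
proof (rule two_independent_grid)
  show "prod.swap ` stripes n m \<subseteq> rect m n" by (auto simp: stripes_def rect_def)
  fix v assume "v \<in> prod.swap ` stripes n m"
  then obtain i j where v: "v = prod.swap (i, j)" "(i, j) \<in> stripes n m" by auto
  show "\<exists>w. \<forall>u\<in>prod.swap ` stripes n m. adj v u \<longrightarrow> u = w"
  proof (intro exI ballI impI)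
    fix u assume "u \<in> prod.swap ` stripes n m" "adj v u"
    then obtain u' where "u = prod.swap u'" "u' \<in> stripes n m" "adj (i, j) u'"
      unfolding v(1) using adj_swap by blast
    then show "u = prod.swap (if j mod 3 = 1 then (i, Suc j) else (i, j - 1))"
      using stripes_nbr[OF v(2)] by blast
  qed
qed

lemma le_beta2:
  assumes "simple_graph G" "two_independent G S"
  shows "card S \<le> beta2 G"
  unfolding beta2_def by (rule Max_ge[OF beta2_wf(1)[OF assms(1)]]) (use assms(2) in blast)

lemma strip_count_le_beta2: "max (strip_count m n) (strip_count n m) \<le> beta2 (grid m n)"
proof (rule max.boundedI)
  show "strip_count m n \<le> beta2 (grid m n)"
    using le_beta2[OF simple_graph_grid[of m n] two_independent_stripes[of m n]] by (simp only: card_stripes)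
  have inj: "inj_on prod.swap (stripes n m)"
    by (rule inj_on_subset[OF inj_swap subset_UNIV])
  have "card (prod.swap ` stripes n m) = card (stripes n m)" by (rule card_image[OF inj])
  then show "strip_count n m \<le> beta2 (grid m n)"
    using le_beta2[OF simple_graph_grid[of m n] two_independent_stripes_swap[of m n]] by (simp only: card_stripes)
qed

section \<open>Comparison of the three graph parameters\<close>

text \<open>
Give every vertex of a 2-independent set its own colour: its closed neighbourhood meets the set
in at most two vertices, so a single vertex is half of it.
\<close>

lemma beta2_le_psi_sq:
  assumes G: "simple_graph G"
  shows "beta2 G \<le> psi_sq G"
proof -
  have "beta2 G \<in> {card S | S. two_independent G S}"
    unfolding beta2_def by (rule Max_in[OF beta2_wf[OF G]])
  then obtain S where S: "two_independent G S" "beta2 G = card S" by blast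
  have fin: "finite S" using S(1) G by (auto simp: two_independent_def simple_graph_def intro: finite_subset)
  obtain h where h: "bij_betw h S {1..card S}"
    using ex_bij_betw_nat_finite_1[OF fin] bij_betw_inv by blast
  define f where "f v = (if v \<in> S then Some (h v) else None)" for v
  have dom: "dom f = S" by (auto simp: f_def split: if_splits)
  have "sub_quorum_coloring G (card S) f"
    unfolding sub_quorum_coloring_def dom
  proof (intro conjI ballI)
    show "S \<subseteq> verts G" using S(1) by (simp add: two_independent_def)
    have "ran f = h ` S" by (auto simp: ran_def f_def image_iff split: if_splits)
    then show "ran f = {1..card S}" using h by (simp add: bij_betw_def)
    fix v assume v: "v \<in> S"
    let ?N = "nbhd (induced_subgraph G S) v"
    have finN: "finite ?N" by (rule finite_subset[OF _ fin]) (auto simp: nbhd_def induced_subgraph_def)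
    have "closed_nbhd G v \<inter> S \<subseteq> insert v ?N"
      using v by (auto simp: closed_nbhd_def nbhd_def induced_subgraph_def)
    then have "card (closed_nbhd G v \<inter> S) \<le> card (insert v ?N)"
      by (rule card_mono[rotated]) (simp add: finN)
    also have "\<dots> \<le> Suc (card ?N)" by (rule card_insert_le_m1[THEN order_trans]) (use finN in \<open>auto simp: card_insert_if\<close>)
    also have "\<dots> \<le> 2" using S(1) v by (auto simp: two_independent_def degree_def)
    finally have "card (closed_nbhd G v \<inter> S) \<le> 2" .
    moreover have "{u \<in> closed_nbhd G v \<inter> S. f u = f v} = {v}"
      using v bij_betw_imp_inj_on[OF h] by (auto simp: f_def closed_nbhd_def inj_on_def)
    ultimately show "1 / 2 * real (card (closed_nbhd G v \<inter> S))
        \<le> real (card {u \<in> closed_nbhd G v \<inter> S. f u = f v})" by simp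
  qed
  then show ?thesis
    unfolding S(2) psi_sq_def by (intro Max_ge psi_sq_wf(1)[OF G]) blast
qed

text \<open>
Choose from every colour class an edge inside the class if there is one, and otherwise any
vertex. In the second case the vertex is alone with its colour in its closed neighbourhood, so
the quorum condition leaves room for only one coloured neighbour.
\<close>

lemma psi_sq_le_Omega:
  assumes G: "simple_graph G"
  shows "psi_sq G \<le> Omega G"
proof -
  have "psi_sq G \<in> {k. \<exists>f. sub_quorum_coloring G k f}"
    unfolding psi_sq_def by (rule Max_in[OF psi_sq_wf[OF G]])
  then obtain f where f: "sub_quorum_coloring G (psi_sq G) f" by blast
  define k where "k = psi_sq G"
  have sub: "dom f \<subseteq> verts G" and ran: "ran f = {1..k}"
    using f unfolding sub_quorum_coloring_def k_def by blast+
  have quorum: "real (card (closed_nbhd G v \<inter> dom f))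
      \<le> 2 * real (card {u \<in> closed_nbhd G v \<inter> dom f. f u = f v})" if "v \<in> dom f" for v
  proof -
    have "1 / 2 * real (card (closed_nbhd G v \<inter> dom f)) \<le> real (card {u \<in> closed_nbhd G v \<inter> dom f. f u = f v})"
      using f that unfolding sub_quorum_coloring_def by blast
    then show ?thesis by simp
  qed
  have edge: "e \<subseteq> verts G" "card e = 2" if "e \<in> edges G" for e
    using G that by (auto simp: simple_graph_def)
  define E where "E c = {e \<in> edges G. \<forall>v\<in>e. f v = Some c}" for c
  define A where "A = {c \<in> {1..k}. E c \<noteq> {}}"
  define ed where "ed c = (SOME e. e \<in> E c)" for c
  define vx where "vx c = (SOME v. f v = Some c)" for c
  have ed: "ed c \<in> E c" if "c \<in> A" for c
    unfolding ed_def by (rule someI_ex) (use that in \<open>auto simp: A_def\<close>)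
  have vx: "f (vx c) = Some c" if "c \<in> {1..k}" for c
    unfolding vx_def by (rule someI_ex) (use that ran in \<open>auto simp: ran_def\<close>)
  have edE: "ed c \<in> edges G" "ed c \<noteq> {}" "\<And>v. v \<in> ed c \<Longrightarrow> f v = Some c" if "c \<in> A" for c
    using ed[OF that] edge(2)[of "ed c"] by (auto simp: E_def)
  define M where "M = ed ` A"
  define T where "T = vx ` ({1..k} - A)"
  have "inj_on ed A"
  proof (rule inj_onI)
    fix c d assume cd: "c \<in> A" "d \<in> A" "ed c = ed d"
    then obtain v where "v \<in> ed c" "v \<in> ed d" using edE(2) by blast
    then show "c = d" using edE(3)[OF cd(1)] edE(3)[OF cd(2)] by force
  qed
  then have cM: "card M = card A" unfolding M_def by (rule card_image)
  have "inj_on vx ({1..k} - A)" using vx by (metis DiffD1 inj_onI option.inject)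
  then have cT: "card T = card ({1..k} - A)" unfolding T_def by (rule card_image)
  have "A \<subseteq> {1..k}" by (auto simp: A_def)
  then have card: "card T + card M = k"
    unfolding cM cT using card_Diff_subset[of A "{1..k}"] card_mono[of "{1..k}" A] finite_subset[of A "{1..k}"]
    by simp
  have domTM: "T \<union> \<Union>M \<subseteq> dom f" using vx edE(3) by (auto simp: T_def M_def)
  have "omega_pair G T M"
    unfolding omega_pair_def matching_def
  proof (intro conjI ballI impI)
    show "M \<subseteq> edges G" using edE(1) by (auto simp: M_def)
    show "e \<inter> e' = {}" if ee: "e \<in> M" "e' \<in> M" "e \<noteq> e'" for e e'
    proof (rule ccontr)
      assume "e \<inter> e' \<noteq> {}"
      then obtain v c c' where "v \<in> ed c" "v \<in> ed c'" "c \<in> A" "c' \<in> A" "e = ed c" "e' = ed c'"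
        using ee unfolding M_def by blast
      then show False using edE(3)[of c v] edE(3)[of c' v] ee(3) by simp
    qed
    show "T \<subseteq> verts G" using domTM sub by blast
    show "T \<inter> \<Union>M = {}"
    proof (rule ccontr)
      assume "T \<inter> \<Union>M \<noteq> {}"
      then obtain c c' where "c \<in> {1..k} - A" "c' \<in> A" "vx c \<in> ed c'" unfolding T_def M_def by blast
      then show False using vx[of c] edE(3)[of c' "vx c"] by simp
    qed
    fix t assume "t \<in> T"
    then obtain c where c: "c \<in> {1..k}" "c \<notin> A" "t = vx c" unfolding T_def by blast
    have ft: "f t = Some c" using vx c by simp
    have fin: "finite (nbhd G t)"
      using G by (auto simp: simple_graph_def nbhd_def)
    have tn: "t \<notin> nbhd G t" using edge(2)[of "{t}"] by (auto simp: nbhd_def)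
    have "{u \<in> closed_nbhd G t \<inter> dom f. f u = f t} = {t}"
    proof -
      have "{u, t} \<in> E c" if "u \<in> nbhd G t" "f u = f t" for u
        using that ft by (auto simp: E_def nbhd_def)
      then show ?thesis using c ft by (auto simp: closed_nbhd_def A_def)
    qed
    then have "real (card (closed_nbhd G t \<inter> dom f)) \<le> 2" using quorum[of t] ft by auto
    moreover have "closed_nbhd G t \<inter> dom f = insert t (nbhd G t \<inter> dom f)"
      using ft by (auto simp: closed_nbhd_def)
    ultimately have "card (nbhd G t \<inter> dom f) \<le> 1" using fin tn by simp
    moreover have "card (nbhd G t \<inter> (T \<union> \<Union>M)) \<le> card (nbhd G t \<inter> dom f)"
      by (rule card_mono) (use fin domTM in auto)
    ultimately show "card (nbhd G t \<inter> (T \<union> \<Union>M)) \<le> 1" by linarith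
  qed
  then have "k \<in> {card T + card M | T M. omega_pair G T M}" using card by blast
  then show ?thesis unfolding Omega_def k_def[symmetric] by (rule Max_ge[OF Omega_wf(1)[OF G]])
qed

text \<open>
The inequalities proved so far close a cycle through \<open>F\<close>,
\<open>\<beta>\<^sub>2\<close>, \<open>\<psi>\<close> and \<open>\<Omega>\<close>.
\<close>

theorem grid_numbers:
  assumes mn: "m \<ge> 1" "n \<ge> 1"
  shows "beta2 (grid m n) = max (strip_count m n) (strip_count n m)"
    and "psi_sq (grid m n) = beta2 (grid m n)"
    and "Omega (grid m n) = beta2 (grid m n)"
proof -
  note G = simple_graph_grid[of m n]
  have "Omega (grid m n) \<in> {card T + card M | T M. omega_pair (grid m n) T M}"
    unfolding Omega_def by (rule Max_in[OF Omega_wf[OF G]])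
  then have "Omega (grid m n) \<le> max (strip_count m n) (strip_count n m)"
    using omega_pair_le[OF mn] by auto
  moreover note strip_count_le_beta2[of m n] beta2_le_psi_sq[OF G] psi_sq_le_Omega[OF G]
  ultimately show "beta2 (grid m n) = max (strip_count m n) (strip_count n m)"
    "psi_sq (grid m n) = beta2 (grid m n)" "Omega (grid m n) = beta2 (grid m n)" by linarith+
qed

theorem theorem5p7:
  fixes n :: nat
  assumes "n \<ge> 1"
  shows
    "(psi_sq (grid 3 n) = beta2 (grid 3 n) \<and>
      int (beta2 (grid 3 n)) = \<lceil>5 * real n / 3\<rceil>) \<and>
     (psi_sq (grid 4 n) = beta2 (grid 4 n) \<and>
      beta2 (grid 4 n) = (if even n then 2 * n else 2 * n + 1)) \<and>
     (psi_sq (grid 5 n) = beta2 (grid 5 n) \<and>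
      int (beta2 (grid 5 n)) =
        max (3 * \<lceil>2 * real n / 3\<rceil> + 2 * \<lfloor>real n / 3\<rfloor>)
            (4 * \<lceil>real n / 2\<rceil> + \<lfloor>real n / 2\<rfloor>)) \<and>
     (psi_sq (grid 6 n) = beta2 (grid 6 n) \<and>
      beta2 (grid 6 n) = (if even n then 3 * n else 3 * n + 1)) \<and>
     (psi_sq (grid 7 n) = beta2 (grid 7 n) \<and>
      int (beta2 (grid 7 n)) =
        max (4 * \<lceil>2 * real n / 3\<rceil> + 3 * \<lfloor>real n / 3\<rfloor>)
            (5 * \<lceil>real n / 2\<rceil> + 2 * \<lfloor>real n / 2\<rfloor>)) \<and>
     (\<forall>m\<in>{8, 9, 10, 11}.
        psi_sq (grid m n) = beta2 (grid m n) \<and>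
        beta2 (grid m n) = Omega (grid m n) \<and>
        int (Omega (grid m n)) = F m n)"
proof -
  have psi: "psi_sq (grid m n) = beta2 (grid m n)"
    and beta: "beta2 (grid m n) = max (strip_count m n) (strip_count n m)"
    and omega: "beta2 (grid m n) = Omega (grid m n)" if "m \<ge> 1" for m
    using grid_numbers[OF that assms] by simp_all
  have F: "int (Omega (grid m n)) = F m n" if "m \<ge> 1" for m
    using beta[OF that] omega[OF that] by (simp add: F_eq)
  have "int (beta2 (grid 3 n)) = \<lceil>5 * real n / 3\<rceil>"
    unfolding ceil_five_thirds using beta[of 3] by (simp add: strip_count_def)
  moreover have "beta2 (grid 4 n) = (if even n then 2 * n else 2 * n + 1)"
    using beta[of 4] by (auto simp: strip_count_def elim!: evenE oddE)
  moreover have "int (beta2 (grid 5 n)) = max (3 * \<lceil>2 * real n / 3\<rceil> + 2 * \<lfloor>real n / 3\<rfloor>)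
            (4 * \<lceil>real n / 2\<rceil> + \<lfloor>real n / 2\<rfloor>)"
    unfolding ceil_two_thirds floor_third ceil_half floor_half using beta[of 5]
    by (simp add: strip_count_def of_nat_max of_nat_diff algebra_simps)
  moreover have "beta2 (grid 6 n) = (if even n then 3 * n else 3 * n + 1)"
    using beta[of 6] by (auto simp: strip_count_def elim!: evenE oddE)
  moreover have "int (beta2 (grid 7 n)) = max (4 * \<lceil>2 * real n / 3\<rceil> + 3 * \<lfloor>real n / 3\<rfloor>)
            (5 * \<lceil>real n / 2\<rceil> + 2 * \<lfloor>real n / 2\<rfloor>)"
    unfolding ceil_two_thirds floor_third ceil_half floor_half using beta[of 7]
    by (simp add: strip_count_def of_nat_max of_nat_diff algebra_simps)
  ultimately show ?thesis using psi omega F by simp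
qed

end
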